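(* Let $\mathfrak{D}^q_{\mathfrak{s}}$ be a quantum cluster scattering diagram of any rank $r$, and let $B=(b_{ij})$, $b_{ij}=\{\delta_ie_i,e_j\}$, be its initial exchange matrix. If there is a pair $i\neq j$ with $b_{ij}\neq0$ such that $\delta_i\nmid\delta_j$ and $\delta_j\nmid\delta_i$, then $\mathfrak{D}^q_{\mathfrak{s}}$ is nonpositive, i.e. it is not positive.
   Context: Fixed data: $N$ is a lattice of finite rank $r$ with basis (seed) $\mathfrak{s}=(e_1,\dots,e_r)$; $\{\cdot,\cdot\}:N\times N\to\mathbb{Q}$ is a skew-symmetric bilinear form; $\delta_1,\dots,\delta_r$ are positive integers such that $N^\circ=\bigoplus_i\mathbb{Z}\,\delta_ie_i$ satisfies $\{N^\circ,N\}\subset\mathbb{Z}$. The initial exchange matrix is $B=(b_{ij})$, $b_{ij}=\{\delta_ie_i,e_j\}$. Let $\delta_0=\mathrm{lcm}(\delta_1,\dots,\delta_r)$, $M_{\mathbb{R}}=\mathrm{Hom}(N,\mathbb{Z})\otimes\mathbb{R}$ with canonical pairing $\langle\cdot,\cdot\rangle:N\times M_{\mathbb{R}}\to\mathbb{R}$, and $n^\perp=\{\xi\in M_{\mathbb{R}}\mid\langle n,\xi\rangle=0\}$. Let $N^+=\{\sum_ia_ie_i\mid a_i\in\mathbb{Z}_{\ge0},\sum_ia_i>0\}$, $N^+_{\mathrm{pr}}$ its subset of primitive vectors, $\deg(\sum_ia_ie_i)=\sum_ia_i$. For $n\in N^+$, $\delta(n)$ is the smallest positive rational number with $\delta(n)n\in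 N^\circ$ (then $1/\delta(n)\in(1/\delta_0)\mathbb{Z}_{>0}$). Structure group: $q$ is an indeterminate, $[\alpha]_q=\frac{q^\alpha-q^{-\alpha}}{q-q^{-1}}$ for $\alpha\in(1/\delta_0)\mathbb{Z}$. $\mathfrak{g}=\bigoplus_{n\in N^+}\mathbb{Q}(q^{1/\delta_0})X_n$ with $[X_n,X_{n'}]=[\{n,n'\}]_qX_{n+n'}$; $\widehat{\mathfrak{g}}$ is its completion with respect to $\deg$; $G=\exp(\widehat{\mathfrak{g}})$ with the Baker–Campbell–Hausdorff product. $G^{>\ell}$ is the normal subgroup of elements $\exp(\sum_{\deg n>\ell}c_nX_n)$, and $G^{\le\ell}=G/G^{>\ell}$. For $n\in N^+_{\mathrm{pr}}$, $G_n^{\parallel}=\{\exp(\sum_{j\ge1}c_jX_{jn})\}$. Powers: $\exp(X)^c=\exp(cX)$. For $n\in N^+$, $a\in(1/\delta_0)\mathbb{Z}_{>0}$, $b\in(1/\delta_0)\mathbb{Z}$: $\Psi_{a,b}[n]=\exp\bigl(\sum_{j\ge1}\frac{(-1)^{j+1}}{j[ja]_q}q^{jb}X_{jn}\bigr)$, and $\Psi_a[n]=\Psi_{a,0}[n]$. Scattering diagrams: a wall is a triple $(\mathfrak{d},g)_n$ with $n\in N^+_{\mathrm{pr}}$ (normal vector), $\mathfrak{d}\subset n^\perp$ a (convex rational polyhedral) cone of codimension 1 in $M_{\mathbb{R}}$, and $g\in G_n^{\parallel}$ (wall element). It is incoming if $p^*(n):=\{\cdot,n\}\in\mathfrak{d}$.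 A scattering diagram $\mathfrak{D}=\{(\mathfrak{d}_\lambda,g_\lambda)_{n_\lambda}\}_{\lambda\in\Lambda}$ is a collection of walls such that for each $\ell$ only finitely many $g_\lambda$ are nontrivial in $G^{\le\ell}$. $\mathrm{Supp}(\mathfrak{D})=\bigcup_\lambda\mathfrak{d}_\lambda$; $\mathrm{Sing}(\mathfrak{D})$ is the union of all boundaries $\partial\mathfrak{d}_\lambda$ and all intersections $\mathfrak{d}_\lambda\cap\mathfrak{d}_{\lambda'}$ of dimension $r-2$. A smooth curve $\gamma:[0,1]\to M_{\mathbb{R}}$ is admissible if its endpoints are not in $\mathrm{Supp}(\mathfrak{D})$, it meets $\mathrm{Supp}(\mathfrak{D})$ transversally, and it avoids $\mathrm{Sing}(\mathfrak{D})$. The path-ordered product $\mathfrak{p}_{\gamma,\mathfrak{D}}\in G$ is the product of $g_\lambda^{\epsilon_\lambda}$ over walls crossed by $\gamma$, in order of crossing (later crossings written to the left), with $\epsilon_\lambda=1$ if $\langle n_\lambda,\gamma'\rangle<0$ and $-1$ if $\langle n_\lambda,\gamma'\rangle>0$ at the crossing. Two diagrams are equivalent if their path-ordered products agree for every curve admissible for both; a diagram is consistent if $\mathfrak{p}_{\gamma,\mathfrak{D}}=\mathrm{id}$ for every admissible loop. A quantum cluster scattering diagram (QCSD) $\mathfrak{D}^q_{\mathfrak{s}}$ is a consistent scattering diagram whose set of incoming walls is $\{(e_i^\perp,\Psi_{1/\delta_i}[e_i])_{e_i}\mid i=1,\dots,r\}$ (it exists and is unique up to equivalence). A QCSD is a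 positive realization if the wall element of every wall has the form $\Psi_{1/\delta(n),b}[n]^c$ with $n\in N^+$, $b\in(1/\delta_0)\mathbb{Z}$, $c\in\mathbb{Z}_{>0}$. A QCSD is positive if it is equivalent to a QCSD that is a positive realization. *)

theory Defs
  imports
    "HOL-Analysis.Analysis"
    "HOL-Computational_Algebra.Polynomial"
    "HOL-Computational_Algebra.Fraction_Field"
begin

text \<open>
  The lattice \<open>N\<close> with basis \<open>e\<^sub>i\<close> is \<open>int ^ 'r\<close> with its standard basis, so the rank is
  \<open>CARD('r)\<close>, and \<open>M\<^sub>\<real>\<close> is \<open>real ^ 'r\<close> in the coordinates of the dual basis.
\<close>

definition basis :: "'r \<Rightarrow> int ^ 'r::finite" where
  "basis i = axis i 1"

definition pairing :: "int ^ 'r::finite \<Rightarrow> real ^ 'r \<Rightarrow> real" where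
  "pairing n \<xi> = (\<Sum>i\<in>UNIV. of_int (n $ i) * \<xi> $ i)"

definition orth :: "int ^ 'r::finite \<Rightarrow> (real ^ 'r) set" where
  "orth n = {\<xi>. pairing n \<xi> = 0}"

definition deg :: "int ^ 'r::finite \<Rightarrow> int" where
  "deg n = (\<Sum>i\<in>UNIV. n $ i)"

definition N_plus :: "(int ^ 'r::finite) set" where
  "N_plus = {n. (\<forall>i. 0 \<le> n $ i) \<and> 0 < deg n}"

definition N_plus_pr :: "(int ^ 'r::finite) set" where
  "N_plus_pr = {n \<in> N_plus. \<forall>k m. 0 < k \<longrightarrow> n = k *s m \<longrightarrow> k = 1}"

definition rational_polyhedral_cone :: "(real ^ 'r::finite) set \<Rightarrow> bool" where
  "rational_polyhedral_cone C \<longleftrightarrow>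
     (\<exists>V :: (int ^ 'r) set. finite V \<and> C = convex_cone hull ((\<lambda>v. \<chi> i. real_of_int (v $ i)) ` V))"

definition smooth_curve :: "(real \<Rightarrow> 'a::real_normed_vector) \<Rightarrow> bool" where
  "smooth_curve \<gamma> \<longleftrightarrow>
     (\<exists>F :: nat \<Rightarrow> real \<Rightarrow> 'a. F 0 = \<gamma> \<and>
        (\<forall>k. \<forall>t\<in>{0..1}. (F k has_vector_derivative F (Suc k) t) (at t within {0..1})))"

definition velocity :: "(real \<Rightarrow> 'a::real_normed_vector) \<Rightarrow> real \<Rightarrow> 'a" where
  "velocity \<gamma> t = vector_derivative \<gamma> (at t within {0..1})"

text \<open>
  The field \<open>\<rat>(q\<^bsup>1/\<delta>\<^sub>0\<^esup>)\<close> is the field of rational functions in one variable, and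
  \<open>q_root\<close> is that variable, i.e. \<open>q\<^bsup>1/\<delta>\<^sub>0\<^esup>\<close>.

  An element \<open>\<Sum>\<^sub>n c\<^sub>n X\<^sub>n\<close> of the completed Lie algebra is its coefficient function
  \<open>n \<mapsto> c\<^sub>n\<close>, which vanishes outside \<open>N_plus\<close>; an element \<open>exp x\<close> of the group is represented
  by \<open>x\<close>.
\<close>

type_synonym qfield = "rat poly fract"

type_synonym 'r lie = "int ^ 'r \<Rightarrow> qfield"

definition q_root :: qfield where
  "q_root = Fract [:0, 1:] 1"

definition G_carrier :: "'r::finite lie set" where
  "G_carrier = {x. \<forall>n. n \<notin> N_plus \<longrightarrow> x n = 0}"

definition G_one :: "'r::finite lie" where
  "G_one = (\<lambda>n. 0)"

definition G_pow :: "'r::finite lie \<Rightarrow> rat \<Rightarrow> 'r lie" where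
  "G_pow x c = (\<lambda>n. Fract [:c:] 1 * x n)"

definition G_gt :: "nat \<Rightarrow> 'r::finite lie set" where
  "G_gt l = {x \<in> G_carrier. \<forall>n. deg n \<le> int l \<longrightarrow> x n = 0}"

definition G_par :: "int ^ 'r::finite \<Rightarrow> 'r lie set" where
  "G_par n = {x \<in> G_carrier. \<forall>m. x m \<noteq> 0 \<longrightarrow> (\<exists>j::nat. 1 \<le> j \<and> m = int j *s n)}"

record 'r wall =
  wall_cone :: "(real ^ 'r) set"
  wall_elt :: "'r lie"
  wall_normal :: "int ^ 'r"

definition is_wall :: "'r::finite wall \<Rightarrow> bool" where
  "is_wall w \<longleftrightarrow>
     wall_normal w \<in> N_plus_pr \<and>
     rational_polyhedral_cone (wall_cone w) \<and>
     wall_cone w \<subseteq> orth (wall_normal w) \<and>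
     aff_dim (wall_cone w) = int CARD('r) - 1 \<and>
     wall_elt w \<in> G_par (wall_normal w)"

text \<open>A collection of walls is an indexed family, so that a wall may be repeated.\<close>

record ('l, 'r) walls =
  index :: "'l set"
  wall_at :: "'l \<Rightarrow> 'r wall"

definition scattering_diagram :: "('l, 'r::finite) walls \<Rightarrow> bool" where
  "scattering_diagram D \<longleftrightarrow>
     (\<forall>k\<in>index D. is_wall (wall_at D k)) \<and>
     (\<forall>l. finite {k \<in> index D. wall_elt (wall_at D k) \<notin> G_gt l})"

definition Supp :: "('l, 'r::finite) walls \<Rightarrow> (real ^ 'r) set" where
  "Supp D = (\<Union>k\<in>index D. wall_cone (wall_at D k))"

definition Sing :: "('l, 'r::finite) walls \<Rightarrow> (real ^ 'r) set" where
  "Sing D =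
     (\<Union>k\<in>index D. rel_frontier (wall_cone (wall_at D k))) \<union>
     \<Union>{wall_cone (wall_at D k) \<inter> wall_cone (wall_at D k') | k k'.
         k \<in> index D \<and> k' \<in> index D \<and>
         aff_dim (wall_cone (wall_at D k) \<inter> wall_cone (wall_at D k')) = int CARD('r) - 2}"

text \<open>
  Outside \<open>Sing D\<close> a curve meets a wall in its relative interior, where the tangent space of the
  wall is \<open>orth n\<close>; hence the form of the transversality condition.
\<close>

definition admissible :: "('l, 'r::finite) walls \<Rightarrow> (real \<Rightarrow> real ^ 'r) \<Rightarrow> bool" where
  "admissible D \<gamma> \<longleftrightarrow>
     smooth_curve \<gamma> \<and>
     \<gamma> 0 \<notin> Supp D \<and> \<gamma> 1 \<notin> Supp D \<and>
     (\<forall>t\<in>{0..1}. \<forall>k\<in>index D. \<gamma> t \<in> wall_cone (wall_at D k) \<longrightarrow>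
        pairing (wall_normal (wall_at D k)) (velocity \<gamma> t) \<noteq> 0) \<and>
     \<gamma> ` {0..1} \<inter> Sing D = {}"

definition crossings :: "nat \<Rightarrow> ('l, 'r::finite) walls \<Rightarrow> (real \<Rightarrow> real ^ 'r) \<Rightarrow> (real \<times> 'l) set" where
  "crossings l D \<gamma> =
     {(t, k). t \<in> {0..1} \<and> k \<in> index D \<and> \<gamma> t \<in> wall_cone (wall_at D k) \<and>
             wall_elt (wall_at D k) \<notin> G_gt l}"

definition crossing_elt ::
  "('l, 'r::finite) walls \<Rightarrow> (real \<Rightarrow> real ^ 'r) \<Rightarrow> real \<times> 'l \<Rightarrow> 'r lie" where
  "crossing_elt D \<gamma> = (\<lambda>(t, k).
     G_pow (wall_elt (wall_at D k))
       (if pairing (wall_normal (wall_at D k)) (velocity \<gamma> t) < 0 then 1 else -1))"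

locale seed_data =
  fixes form :: "int ^ 'r::finite \<Rightarrow> int ^ 'r \<Rightarrow> rat"
    and \<delta> :: "'r \<Rightarrow> nat"
  assumes form_add_left: "form (m + n) k = form m k + form n k"
    and form_add_right: "form k (m + n) = form k m + form k n"
    and form_skew: "form m n = - form n m"
    and \<delta>_pos: "0 < \<delta> i"
    and form_integral: "(\<And>i. int (\<delta> i) dvd m $ i) \<Longrightarrow> form m n \<in> \<int>"
begin

definition N_circ :: "(int ^ 'r) set" where
  "N_circ = {n. \<forall>i. int (\<delta> i) dvd n $ i}"

definition exchange_matrix :: "'r \<Rightarrow> 'r \<Rightarrow> rat" where
  "exchange_matrix i j = form (int (\<delta> i) *s basis i) (basis j)"

definition \<delta>\<^sub>0 :: nat where
  "\<delta>\<^sub>0 = Lcm (range \<delta>)"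

definition \<delta>_of :: "int ^ 'r \<Rightarrow> rat" where
  "\<delta>_of n = (LEAST s. 0 < s \<and> (\<exists>m\<in>N_circ. \<forall>i. of_int (m $ i) = s * of_int (n $ i)))"

definition p_star :: "int ^ 'r \<Rightarrow> real ^ 'r" where
  "p_star n = (\<chi> i. of_rat (form (basis i) n))"

text \<open>\<open>q_power \<alpha>\<close> is \<open>q\<^bsup>\<alpha>\<^esup>\<close>; it is only used for \<open>\<alpha>\<close> in \<open>(1/\<delta>\<^sub>0)\<int>\<close>, where the floor is exact.\<close>

definition q_power :: "rat \<Rightarrow> qfield" where
  "q_power \<alpha> = q_root powi \<lfloor>of_nat \<delta>\<^sub>0 * \<alpha>\<rfloor>"

definition q_number :: "rat \<Rightarrow> qfield" where
  "q_number \<alpha> = (q_power \<alpha> - q_power (- \<alpha>)) / (q_power 1 - q_power (- 1))"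

definition bracket :: "'r lie \<Rightarrow> 'r lie \<Rightarrow> 'r lie" where
  "bracket x y = (\<lambda>n. \<Sum>(a, b) | a \<in> N_plus \<and> b \<in> N_plus \<and> a + b = n.
     x a * y b * q_number (form a b))"

fun nested_bracket :: "'r lie list \<Rightarrow> 'r lie" where
  "nested_bracket [] = (\<lambda>n. 0)"
| "nested_bracket [x] = x"
| "nested_bracket (x # y # zs) = bracket x (nested_bracket (y # zs))"

text \<open>
  Dynkin's form of the Baker--Campbell--Hausdorff series: the entries \<open>(r\<^sub>1, s\<^sub>1), \<dots>, (r\<^sub>k, s\<^sub>k)\<close>
  of \<open>ps\<close> are the exponents in
  \[ \sum_{k \ge 1} \frac{(-1)^{k-1}}{k} \sum_{r_i + s_i > 0}
       \frac{[x^{r_1} y^{s_1} \cdots x^{r_k} y^{s_k}]}{\sum_i (r_i + s_i) \prod_i r_i!\, s_i!}. \]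
  Brackets of more than \<open>deg n\<close> factors have no component at \<open>n\<close>, so that truncating the series
  there does not change the coefficient.
\<close>

definition dynkin_length :: "(nat \<times> nat) list \<Rightarrow> nat" where
  "dynkin_length ps = (\<Sum>(r, s)\<leftarrow>ps. r + s)"

definition dynkin_coeff :: "(nat \<times> nat) list \<Rightarrow> qfield" where
  "dynkin_coeff ps = (- 1) ^ (length ps - 1) /
     of_nat (length ps * dynkin_length ps * (\<Prod>(r, s)\<leftarrow>ps. fact r * fact s))"

definition dynkin_bracket :: "'r lie \<Rightarrow> 'r lie \<Rightarrow> (nat \<times> nat) list \<Rightarrow> 'r lie" where
  "dynkin_bracket x y ps =
     nested_bracket (concat (map (\<lambda>(r, s). replicate r x @ replicate s y) ps))"

definition G_mult :: "'r lie \<Rightarrow> 'r lie \<Rightarrow> 'r lie" where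
  "G_mult x y = (\<lambda>n.
     \<Sum>ps | ps \<noteq> [] \<and> (\<forall>(r, s)\<in>set ps. 0 < r + s) \<and> int (dynkin_length ps) \<le> deg n.
       dynkin_coeff ps * dynkin_bracket x y ps n)"

text \<open>Equality of the images in the quotient of the group by \<open>G_gt l\<close>.\<close>

definition G_eq_upto :: "nat \<Rightarrow> 'r lie \<Rightarrow> 'r lie \<Rightarrow> bool" where
  "G_eq_upto l x y \<longleftrightarrow> G_mult (G_pow x (- 1)) y \<in> G_gt l"

text \<open>The sum over \<open>j\<close> has at most one term, since \<open>n \<noteq> 0\<close>.\<close>

definition \<Psi> :: "rat \<Rightarrow> rat \<Rightarrow> int ^ 'r \<Rightarrow> 'r lie" where
  "\<Psi> a b n = (\<lambda>m. \<Sum>j::nat | 1 \<le> j \<and> m = int j *s n.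
     (- 1) ^ (j + 1) / (of_nat j * q_number (of_nat j * a)) * q_power (of_nat j * b))"

text \<open>
  \<open>p\<close> is the path-ordered product of \<open>D\<close> along \<open>\<gamma>\<close> if, in each quotient by \<open>G_gt l\<close>, it is the
  product over the finitely many crossings of walls that are nontrivial there. Walls crossed at
  the same time have the same normal vector, so that their elements commute and their relative
  order is immaterial.
\<close>

definition has_path_product ::
  "('l, 'r) walls \<Rightarrow> (real \<Rightarrow> real ^ 'r) \<Rightarrow> 'r lie \<Rightarrow> bool" where
  "has_path_product D \<gamma> p \<longleftrightarrow>
     p \<in> G_carrier \<and>
     (\<forall>l. \<exists>cs. distinct cs \<and> set cs = crossings l D \<gamma> \<and> sorted (map fst cs) \<and>
        G_eq_upto l p (fold (\<lambda>c g. G_mult (crossing_elt D \<gamma> c) g) cs G_one))"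

definition consistent :: "('l, 'r) walls \<Rightarrow> bool" where
  "consistent D \<longleftrightarrow> (\<forall>\<gamma>. admissible D \<gamma> \<and> \<gamma> 0 = \<gamma> 1 \<longrightarrow> has_path_product D \<gamma> G_one)"

definition equivalent :: "('l, 'r) walls \<Rightarrow> ('m, 'r) walls \<Rightarrow> bool" where
  "equivalent D D' \<longleftrightarrow>
     (\<forall>\<gamma>. admissible D \<gamma> \<and> admissible D' \<gamma> \<longrightarrow>
        (\<exists>p. has_path_product D \<gamma> p \<and> has_path_product D' \<gamma> p))"

definition incoming :: "'r wall \<Rightarrow> bool" where
  "incoming w \<longleftrightarrow> p_star (wall_normal w) \<in> wall_cone w"

definition initial_wall :: "'r \<Rightarrow> 'r wall" where
  "initial_wall i =
     \<lparr>wall_cone = orth (basis i), wall_elt = \<Psi> (1 / of_nat (\<delta> i)) 0 (basis i),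
      wall_normal = basis i\<rparr>"

text \<open>The bijection says that each initial wall occurs exactly once among the incoming walls.\<close>

definition QCSD :: "('l, 'r) walls \<Rightarrow> bool" where
  "QCSD D \<longleftrightarrow>
     scattering_diagram D \<and> consistent D \<and>
     bij_betw (wall_at D) {k \<in> index D. incoming (wall_at D k)} (range initial_wall)"

definition positive_realization :: "('l, 'r) walls \<Rightarrow> bool" where
  "positive_realization D \<longleftrightarrow>
     QCSD D \<and>
     (\<forall>k\<in>index D. \<exists>n\<in>N_plus. \<exists>b c. of_nat \<delta>\<^sub>0 * b \<in> \<int> \<and> 0 < (c::nat) \<and>
        wall_elt (wall_at D k) = G_pow (\<Psi> (1 / \<delta>_of n) b n) (of_nat c))"

text \<open>
  HOL cannot quantify over the index type of the second diagram inside a formula; it is passed as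
  an argument instead. All wall elements of a positive realization are nontrivial, so that its
  index set is countable and \<open>'m = nat\<close> already covers every case.
\<close>

definition positive :: "'m itself \<Rightarrow> ('l, 'r) walls \<Rightarrow> bool" where
  "positive _ D \<longleftrightarrow> QCSD D \<and> (\<exists>D' :: ('m, 'r) walls. positive_realization D' \<and> equivalent D D')"

end

end

theory Submission
  imports Defs
begin

text \<open>
  Only the coefficients at \<open>e\<^sub>i\<close>, \<open>e\<^sub>j\<close> and \<open>e\<^sub>i + e\<^sub>j\<close> matter; the group acts on them through a
  Heisenberg quotient. By symmetry let \<open>{e\<^sub>i, e\<^sub>j} > 0\<close>. Take a small generic perturbation of an
  ellipse around the origin in the plane spanned by \<open>p\<^sup>*(e\<^sub>i)\<close> and \<open>p\<^sup>*(e\<^sub>j)\<close>. Near \<open>p\<^sup>*(e\<^sub>i)\<close> and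
  \<open>p\<^sup>*(e\<^sub>j)\<close> it crosses only the incoming walls with these normals, and near \<open>p\<^sup>*(e\<^sub>i + e\<^sub>j)\<close> it
  crosses no wall with normal \<open>e\<^sub>i + e\<^sub>j\<close>. Consistency along this loop forces the walls with
  normal \<open>e\<^sub>i + e\<^sub>j\<close> on the opposite side to have total coefficient
  \<open>[{e\<^sub>i, e\<^sub>j}] / ([1/\<delta>\<^sub>i] [1/\<delta>\<^sub>j])\<close>. In a positive realization this total is
  \<open>(\<Sum> c q\<^sup>b) / [1/L]\<close> with \<open>L = lcm \<delta>\<^sub>i \<delta>\<^sub>j\<close> and all \<open>c > 0\<close>. When neither of \<open>\<delta>\<^sub>i\<close>, \<open>\<delta>\<^sub>j\<close>
  divides the other, both differ from \<open>L\<close>, and \<open>[{e\<^sub>i, e\<^sub>j}] [1/L] / ([1/\<delta>\<^sub>i] [1/\<delta>\<^sub>j])\<close> has a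
  negative coefficient just above its lowest term.
\<close>

section \<open>Generic elliptic loops\<close>

definition ellipse :: "'a::real_normed_vector \<Rightarrow> real \<Rightarrow> 'a \<Rightarrow> 'a \<Rightarrow> real \<Rightarrow> 'a" where
  "ellipse p \<rho> u v t = p + \<rho> *\<^sub>R (cos (2 * pi * t) *\<^sub>R u + sin (2 * pi * t) *\<^sub>R v)"

definition ellipse_velocity :: "real \<Rightarrow> 'a::real_normed_vector \<Rightarrow> 'a \<Rightarrow> real \<Rightarrow> 'a" where
  "ellipse_velocity \<rho> u v t = (2 * pi * \<rho>) *\<^sub>R (cos (2 * pi * t) *\<^sub>R v - sin (2 * pi * t) *\<^sub>R u)"

lemma ellipse_has_vector_derivative:
  "(ellipse p \<rho> u v has_vector_derivative ellipse_velocity \<rho> u v t) (at t within S)"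
  unfolding ellipse_def ellipse_velocity_def
  by (rule derivative_eq_intros refl)+ (auto simp: algebra_simps has_field_derivative_def intro!: derivative_eq_intros)

lemma ellipse_velocity_eq: "ellipse_velocity \<rho> u v = ellipse 0 (2 * pi * \<rho>) v (- u)"
  by (auto simp: ellipse_velocity_def ellipse_def algebra_simps)

text \<open>The derivative of an ellipse is again an ellipse, centred at 0 with axes
  \<open>v\<close> and \<open>- u\<close>, so all higher derivatives come from iterating one
  substitution of parameters.\<close>

lemma smooth_ellipse: "smooth_curve (ellipse p \<rho> u v)"
proof -
  define G where "G k = rec_nat (p, \<rho>, u, v) (\<lambda>_ (p, \<rho>, u, v). (0, 2 * pi * \<rho>, v, - u)) k" for k
  define F where "F k = (case G k of (p, \<rho>, u, v) \<Rightarrow> ellipse p \<rho> u v)" for k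
  have "(F k has_vector_derivative F (Suc k) t) (at t within {0..1})" for k t
    using ellipse_has_vector_derivative
    by (auto simp: F_def G_def ellipse_velocity_eq split: prod.splits)
  moreover have "F 0 = ellipse p \<rho> u v" by (simp add: F_def G_def)
  ultimately show ?thesis unfolding smooth_curve_def by blast
qed

lemma velocity_ellipse: "t \<in> {0..1} \<Longrightarrow> velocity (ellipse p \<rho> u v) t = ellipse_velocity \<rho> u v t"
  unfolding velocity_def
  using vector_derivative_within_cbox[of 0 1 t, OF _ _ ellipse_has_vector_derivative] by simp

lemma pairing_eq_inner: "pairing n \<xi> = (\<chi> i. real_of_int (n $ i)) \<bullet> \<xi>"
  by (simp add: pairing_def inner_vec_def)

lemma rational_polyhedral_coneD:
  assumes "rational_polyhedral_cone C"
  shows "polyhedron C" "closed C" "convex_cone C" "0 \<in> C"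
  using assms by (auto simp: rational_polyhedral_cone_def polyhedron_convex_cone_hull
      closed_convex_cone_hull convex_cone_convex_cone_hull convex_cone_hull_contains_0)

text \<open>A nonzero point \<open>x\<close> of a face is the midpoint of 0 and
  \<open>2 *\<^sub>R x\<close>, both in the cone, so the face contains these endpoints.\<close>

lemma facet_of_cone_contains_0:
  assumes "F facet_of C" "convex_cone C" "0 \<in> C"
  shows "0 \<in> F"
proof -
  obtain x where x: "x \<in> F" using assms unfolding facet_of_def by blast
  show ?thesis
  proof (cases "x = 0")
    case False
    have face: "F face_of C" using assms by (simp add: facet_of_def)
    have "x \<in> C" using face x by (auto simp: face_of_def)
    then have "2 *\<^sub>R x \<in> C" using assms(2) convex_cone_scaleR by fastforce
    moreover have "x \<in> open_segment 0 (2 *\<^sub>R x)"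
      using False by (auto simp: in_segment intro!: exI[of _ "1/2"])
    ultimately show ?thesis using face x assms(3) unfolding face_of_def by blast
  qed (use x in auto)
qed

text \<open>The relative boundary is the union of the finitely many facets. A facet contains 0, so
  its affine dimension is the linear dimension of its span.\<close>

lemma rel_frontier_cone_cover:
  fixes C :: "(real ^ 'r::finite) set"
  assumes "rational_polyhedral_cone C" "aff_dim C = int CARD('r) - 1"
  obtains \<A> where "countable \<A>" "rel_frontier C \<subseteq> \<Union>\<A>"
    "\<And>L. L \<in> \<A> \<Longrightarrow> subspace L \<and> int (dim L) = int CARD('r) - 2"
proof
  note C = rational_polyhedral_coneD[OF assms(1)]
  let ?A = "span ` {F. F facet_of C}"
  show "countable ?A" using finite_polyhedron_facets[OF C(1)] countable_finite by blast
  show "rel_frontier C \<subseteq> \<Union>?A"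
    using rel_frontier_of_polyhedron[OF C(1)] span_superset by fastforce
  fix L assume "L \<in> ?A"
  then obtain F where F: "L = span F" "F facet_of C" by auto
  have "0 \<in> F" using facet_of_cone_contains_0[OF F(2) C(3,4)] .
  then have "aff_dim F = int (dim F)" by (simp add: aff_dim_zero hull_inc)
  then show "subspace L \<and> int (dim L) = int CARD('r) - 2"
    using F assms(2) by (simp add: facet_of_def)
qed

text \<open>Boundaries are covered facet by facet. An intersection of two cones contains 0, so its
  affine dimension is again the dimension of its span. Only walls and pairs of walls are involved,
  which preserves countability.\<close>

lemma Sing_cover:
  fixes D :: "('l, 'r::finite) walls"
  assumes "countable (index D)" "\<And>k. k \<in> index D \<Longrightarrow> is_wall (wall_at D k)"
  obtains \<A> where "countable \<A>" "Sing D \<subseteq> \<Union>\<A>"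
    "\<And>L. L \<in> \<A> \<Longrightarrow> subspace L \<and> int (dim L) = int CARD('r) - 2"
proof -
  let ?P = "\<lambda>\<A> k. countable \<A> \<and> rel_frontier (wall_cone (wall_at D k)) \<subseteq> \<Union>\<A> \<and>
    (\<forall>L\<in>\<A>. subspace L \<and> int (dim L) = int CARD('r) - 2)"
  have "\<exists>\<A>. ?P \<A> k" if "k \<in> index D" for k
    using assms(2)[OF that] unfolding is_wall_def by (metis rel_frontier_cone_cover)
  then obtain A where A: "\<And>k. k \<in> index D \<Longrightarrow> ?P (A k) k" by metis
  define J where "J = {(k, k'). k \<in> index D \<and> k' \<in> index D \<and>
     aff_dim (wall_cone (wall_at D k) \<inter> wall_cone (wall_at D k')) = int CARD('r) - 2}"
  define \<B> where "\<B> = (\<lambda>(k, k'). span (wall_cone (wall_at D k) \<inter> wall_cone (wall_at D k'))) ` J"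
  have "J \<subseteq> index D \<times> index D" by (auto simp: J_def)
  then have "countable J" using assms(1) countable_SIGMA countable_subset by metis
  then have cB: "countable \<B>" by (simp add: \<B>_def)
  have dB: "subspace L \<and> int (dim L) = int CARD('r) - 2" if L: "L \<in> \<B>" for L
  proof -
    obtain k k' where k: "(k, k') \<in> J" "L = span (wall_cone (wall_at D k) \<inter> wall_cone (wall_at D k'))"
      using L by (auto simp: \<B>_def)
    have "0 \<in> wall_cone (wall_at D k) \<inter> wall_cone (wall_at D k')"
      using k(1) assms(2) by (auto simp: J_def is_wall_def intro: rational_polyhedral_coneD)
    then have "aff_dim (wall_cone (wall_at D k) \<inter> wall_cone (wall_at D k')) =
        int (dim (wall_cone (wall_at D k) \<inter> wall_cone (wall_at D k')))"
      by (simp add: aff_dim_zero hull_inc)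
    then show ?thesis using k by (simp add: J_def)
  qed
  show ?thesis
  proof
    show "countable ((\<Union>k\<in>index D. A k) \<union> \<B>)" using A cB assms(1) by (intro countable_Un countable_UN) blast+
    have "\<Union>{wall_cone (wall_at D k) \<inter> wall_cone (wall_at D k') | k k'. (k, k') \<in> J} \<subseteq> \<Union>\<B>"
    proof (intro Union_least)
      fix X assume "X \<in> {wall_cone (wall_at D k) \<inter> wall_cone (wall_at D k') | k k'. (k, k') \<in> J}"
      then obtain k k' where k: "(k, k') \<in> J" "X = wall_cone (wall_at D k) \<inter> wall_cone (wall_at D k')"
        by blast
      then have "span X \<in> \<B>" by (force simp: \<B>_def)
      then show "X \<subseteq> \<Union>\<B>" using span_superset[of X] by blast
    qed
    then have "\<Union>{wall_cone (wall_at D k) \<inter> wall_cone (wall_at D k') | k k'.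
         k \<in> index D \<and> k' \<in> index D \<and>
         aff_dim (wall_cone (wall_at D k) \<inter> wall_cone (wall_at D k')) = int CARD('r) - 2} \<subseteq> \<Union>\<B>"
      by (simp add: J_def)
    moreover have "(\<Union>k\<in>index D. rel_frontier (wall_cone (wall_at D k))) \<subseteq> \<Union>(\<Union>k\<in>index D. A k)"
    proof (rule UN_least)
      fix k assume k: "k \<in> index D"
      have "A k \<subseteq> (\<Union>k\<in>index D. A k)" using k by (rule UN_upper)
      then have "\<Union>(A k) \<subseteq> \<Union>(\<Union>k\<in>index D. A k)" by (rule Union_mono)
      then show "rel_frontier (wall_cone (wall_at D k)) \<subseteq> \<Union>(\<Union>k\<in>index D. A k)"
        using A[OF k] by (meson order_trans)
    qed
    ultimately show "Sing D \<subseteq> \<Union>((\<Union>k\<in>index D. A k) \<union> \<B>)"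
      unfolding Sing_def Union_Un_distrib by (intro Un_mono)
    show "subspace L \<and> int (dim L) = int CARD('r) - 2" if "L \<in> (\<Union>k\<in>index D. A k) \<union> \<B>" for L
      using that
    proof
      assume "L \<in> (\<Union>k\<in>index D. A k)"
      then obtain k where "k \<in> index D" "L \<in> A k" by (rule UN_E)
      then show ?thesis using A by simp
    qed (rule dB)
  qed
qed

lemma countable_at_most_one:
  assumes "\<And>x y. x \<in> S \<Longrightarrow> y \<in> S \<Longrightarrow> x = y"
  shows "countable S"
proof (cases "S = {}")
  case False
  then obtain x where "x \<in> S" by blast
  then have "S \<subseteq> {x}" using assms by blast
  then show ?thesis by (rule countable_subset) simp
qed simp

text \<open>
  The centre \<open>p\<close> avoids countably many proper subspaces; then every wall and every subspace of
  codimension 2 excludes at most one radius.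
\<close>

lemma generic_ellipse:
  fixes D :: "('l, 'r::finite) walls" and u v :: "real ^ 'r"
  assumes cnt: "countable (index D)" and wall: "\<And>k. k \<in> index D \<Longrightarrow> is_wall (wall_at D k)"
    and indep: "\<And>a b. a *\<^sub>R u + b *\<^sub>R v = 0 \<Longrightarrow> a = 0 \<and> b = 0" and "0 < \<epsilon>"
  obtains p \<rho> where "norm p < \<epsilon>" "1 < \<rho>" "\<rho> < 2" "admissible D (ellipse p \<rho> u v)"
proof -
  obtain \<A> where A: "countable \<A>" "Sing D \<subseteq> \<Union>\<A>"
    "\<And>L. L \<in> \<A> \<Longrightarrow> subspace L \<and> int (dim L) = int CARD('r) - 2"
    using Sing_cover[OF cnt wall] by blast
  define N where "N k = (\<chi> i. real_of_int (wall_normal (wall_at D k) $ i))" for k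
  have pair: "pairing (wall_normal (wall_at D k)) x = N k \<bullet> x" for k x
    by (simp add: pairing_eq_inner N_def)
  have N0: "N k \<noteq> 0" if k: "k \<in> index D" for k
  proof
    assume "N k = 0"
    then have "wall_normal (wall_at D k) = 0" by (simp add: N_def vec_eq_iff)
    then show False using wall[OF k] by (simp add: is_wall_def N_plus_pr_def N_plus_def deg_def)
  qed
  define T where "T = span {u, v}"
  have "v \<noteq> 0" "u \<notin> span {v}"
    using indep[of 0 1] indep[of 1 "- c" for c] by (auto simp: span_singleton)
  then have "independent {u, v}" "u \<noteq> v"
    by (auto simp: independent_insert span_base)
  then have dT: "dim T = 2" by (simp add: T_def dim_eq_card_independent)
  \<comment> \<open>If \<open>S L\<close> is not the whole space, a centre \<open>p\<close> outside
    it keeps the plane \<open>p + T\<close> away from \<open>L\<close>. Otherwise the dimension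
    formula makes \<open>L\<close> and \<open>T\<close> meet only in 0, so \<open>p + T\<close> has
    at most one point in \<open>L\<close>.\<close>
  define S where "S L = {x + y |x y. x \<in> L \<and> y \<in> T}" for L
  let ?bad = "(\<Union>k\<in>index D. {x. N k \<bullet> x = 0}) \<union> \<Union>(S ` {L\<in>\<A>. dim (S L) < CARD('r)})"
  have "negligible (\<Union>((\<lambda>k. {x. N k \<bullet> x = 0}) ` index D))"
    using cnt N0 by (intro negligible_countable_Union) (auto intro!: negligible_hyperplane)
  moreover have "negligible (\<Union>(S ` {L\<in>\<A>. dim (S L) < CARD('r)}))"
    using A(1) by (intro negligible_countable_Union) (auto intro!: negligible_lowdim)
  ultimately have "negligible ?bad" by (rule negligible_Un)
  moreover have "\<not> negligible (ball (0 :: real ^ 'r) \<epsilon>)"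
    using \<open>0 < \<epsilon>\<close> by (intro open_not_negligible) auto
  ultimately obtain p where p: "p \<in> ball 0 \<epsilon>" "p \<notin> ?bad"
    using negligible_subset by blast
  have pN: "N k \<bullet> p \<noteq> 0" if "k \<in> index D" for k using p(2) that by blast
  define c where "c \<theta> = cos \<theta> *\<^sub>R u + sin \<theta> *\<^sub>R v" for \<theta> :: real
  have cT: "r *\<^sub>R c \<theta> \<in> T" for r \<theta>
    unfolding c_def T_def by (intro span_scale span_add) (auto intro: span_base)
  \<comment> \<open>Three kinds of bad radii: the ellipse touches the hyperplane of a wall
    tangentially, starts on it, or runs through a codimension 2 subspace.\<close>
  define R1 where "R1 k = {\<rho>. 0 < \<rho> \<and> (\<exists>\<theta>. N k \<bullet> (p + \<rho> *\<^sub>R c \<theta>) = 0 \<and>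
     N k \<bullet> (cos \<theta> *\<^sub>R v - sin \<theta> *\<^sub>R u) = 0)}" for k
  define R2 where "R2 k = {\<rho>. N k \<bullet> (p + \<rho> *\<^sub>R u) = 0}" for k
  define R3 where "R3 L = {\<rho>. 0 < \<rho> \<and> (\<exists>\<theta>. p + \<rho> *\<^sub>R c \<theta> \<in> L)}" for L
  have R1: "countable (R1 k)" if k: "k \<in> index D" for k
  proof (rule countable_at_most_one)
    \<comment> \<open>Squaring and adding the contact and the tangency equation eliminates the
      angle. As \<open>p\<close> is off the hyperplane, this determines the radius.\<close>
    have key: "(N k \<bullet> p)\<^sup>2 = \<rho>\<^sup>2 * ((N k \<bullet> u)\<^sup>2 + (N k \<bullet> v)\<^sup>2)" if "\<rho> \<in> R1 k" for \<rho>
    proof -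
      obtain \<theta> where 1: "N k \<bullet> (p + \<rho> *\<^sub>R c \<theta>) = 0" and 2: "N k \<bullet> (cos \<theta> *\<^sub>R v - sin \<theta> *\<^sub>R u) = 0"
        using \<open>\<rho> \<in> R1 k\<close> by (auto simp: R1_def)
      let ?a = "N k \<bullet> u" and ?b = "N k \<bullet> v"
      have e1: "N k \<bullet> p = - \<rho> * (cos \<theta> * ?a + sin \<theta> * ?b)"
        using 1 by (simp add: c_def inner_simps algebra_simps)
      have e2: "cos \<theta> * ?b - sin \<theta> * ?a = 0" using 2 by (simp add: inner_simps)
      have "(cos \<theta> * ?a + sin \<theta> * ?b)\<^sup>2 + (cos \<theta> * ?b - sin \<theta> * ?a)\<^sup>2
          = ((cos \<theta>)\<^sup>2 + (sin \<theta>)\<^sup>2) * (?a\<^sup>2 + ?b\<^sup>2)"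
        by algebra
      then have "(cos \<theta> * ?a + sin \<theta> * ?b)\<^sup>2 = ?a\<^sup>2 + ?b\<^sup>2" using e2 by simp
      then show ?thesis using e1 by (simp add: power_mult_distrib)
    qed
    fix x y assume xy: "x \<in> R1 k" "y \<in> R1 k"
    let ?s = "(N k \<bullet> u)\<^sup>2 + (N k \<bullet> v)\<^sup>2"
    have "?s \<noteq> 0" using key[OF xy(1)] pN[OF k] by auto
    then have "x\<^sup>2 = y\<^sup>2" using key[OF xy(1)] key[OF xy(2)] by (metis mult_right_cancel)
    then show "x = y" using xy by (simp add: R1_def power2_eq_iff_nonneg)
  qed
  have R2: "countable (R2 k)" if k: "k \<in> index D" for k
  proof (rule countable_at_most_one)
    fix x y assume xy: "x \<in> R2 k" "y \<in> R2 k"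
    then have "x * (N k \<bullet> u) = - (N k \<bullet> p)" "y * (N k \<bullet> u) = - (N k \<bullet> p)"
      by (auto simp: R2_def inner_simps)
    then show "x = y" using pN[OF k] by (metis mult_cancel_right mult_zero_right neg_equal_0_iff_equal)
  qed
  have R3: "countable (R3 L)" if L: "L \<in> \<A>" for L
  proof (cases "dim (S L) < CARD('r)")
    case True
    then have "p \<notin> S L" using p(2) L by blast
    have "R3 L = {}"
    proof (rule ccontr)
      assume "R3 L \<noteq> {}"
      then obtain \<rho> \<theta> where "p + \<rho> *\<^sub>R c \<theta> \<in> L" by (auto simp: R3_def)
      moreover have "- (\<rho> *\<^sub>R c \<theta>) \<in> T" using cT[of "- \<rho>" \<theta>] by simp
      moreover have "p = (p + \<rho> *\<^sub>R c \<theta>) + - (\<rho> *\<^sub>R c \<theta>)" by simp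
      ultimately have "p \<in> S L" unfolding S_def by blast
      with \<open>p \<notin> S L\<close> show False ..
    qed
    then show ?thesis by simp
  next
    case False
    have sL: "subspace L" "int (dim L) = int CARD('r) - 2" using A(3)[OF L] by auto
    have "dim (S L) + dim (L \<inter> T) = dim L + dim T"
      unfolding S_def by (rule dim_sums_Int) (use sL in \<open>auto simp: T_def\<close>)
    then have "dim (L \<inter> T) = 0" using False dT sL(2) by linarith
    then have LT: "x = 0" if "x \<in> L" "x \<in> T" for x using that by (auto simp: dim_eq_0)
    show ?thesis
    proof (rule countable_at_most_one)
      fix x y assume "x \<in> R3 L" "y \<in> R3 L"
      then obtain a b where xy: "0 < x" "0 < y" "p + x *\<^sub>R c a \<in> L" "p + y *\<^sub>R c b \<in> L"
        by (auto simp: R3_def)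
      have "x *\<^sub>R c a - y *\<^sub>R c b \<in> L"
        using subspace_diff[OF sL(1) xy(3,4)] by simp
      moreover have "x *\<^sub>R c a - y *\<^sub>R c b \<in> T"
        using cT unfolding T_def by (intro span_diff)
      ultimately have "x *\<^sub>R c a - y *\<^sub>R c b = 0" using LT by blast
      then have "(x * cos a - y * cos b) *\<^sub>R u + (x * sin a - y * sin b) *\<^sub>R v = 0"
        by (simp add: c_def algebra_simps)
      from indep[OF this] have e: "x * cos a = y * cos b" "x * sin a = y * sin b" by auto
      have "x\<^sup>2 * ((cos a)\<^sup>2 + (sin a)\<^sup>2) = (x * cos a)\<^sup>2 + (x * sin a)\<^sup>2" by algebra
      also have "\<dots> = y\<^sup>2 * ((cos b)\<^sup>2 + (sin b)\<^sup>2)"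
        unfolding e by algebra
      finally have "x\<^sup>2 = y\<^sup>2" by simp
      then show "x = y" using xy by (simp add: power2_eq_iff_nonneg)
    qed
  qed
  have "countable ((\<Union>k\<in>index D. R1 k \<union> R2 k) \<union> (\<Union>L\<in>\<A>. R3 L))"
    using cnt A(1) R1 R2 R3 by (intro countable_Un countable_UN) blast+
  moreover have "uncountable {1<..<2::real}" by (simp add: uncountable_open_interval)
  ultimately have "\<not> {1<..<2} \<subseteq> (\<Union>k\<in>index D. R1 k \<union> R2 k) \<union> (\<Union>L\<in>\<A>. R3 L)"
    by (meson countable_subset)
  then obtain \<rho> where \<rho>: "\<rho> \<in> {1<..<2}" "\<rho> \<notin> (\<Union>k\<in>index D. R1 k \<union> R2 k) \<union> (\<Union>L\<in>\<A>. R3 L)"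
    by (meson subsetI)
  have ell: "ellipse p \<rho> u v t = p + \<rho> *\<^sub>R c (2 * pi * t)" for t by (simp add: ellipse_def c_def)
  have start: "p + \<rho> *\<^sub>R u \<notin> Supp D"
  proof
    assume "p + \<rho> *\<^sub>R u \<in> Supp D"
    then obtain k where k: "k \<in> index D" "p + \<rho> *\<^sub>R u \<in> wall_cone (wall_at D k)"
      by (auto simp: Supp_def)
    then have "N k \<bullet> (p + \<rho> *\<^sub>R u) = 0"
      using wall[OF k(1)] pair by (auto simp: is_wall_def orth_def)
    then show False using \<rho>(2) k(1) by (auto simp: R2_def)
  qed
  have "admissible D (ellipse p \<rho> u v)"
    unfolding admissible_def
  proof (intro conjI ballI impI smooth_ellipse)
    show "ellipse p \<rho> u v 0 \<notin> Supp D" "ellipse p \<rho> u v 1 \<notin> Supp D"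
      using start by (simp_all add: ellipse_def)
    show "ellipse p \<rho> u v ` {0..1} \<inter> Sing D = {}"
    proof (rule ccontr)
      assume "ellipse p \<rho> u v ` {0..1} \<inter> Sing D \<noteq> {}"
      then obtain t where "ellipse p \<rho> u v t \<in> Sing D" by blast
      then obtain L where "L \<in> \<A>" "p + \<rho> *\<^sub>R c (2 * pi * t) \<in> L" using A(2) by (auto simp: ell)
      then show False using \<rho> by (auto simp: R3_def)
    qed
  next
    fix t k assume t: "t \<in> {0..1::real}" and k: "k \<in> index D" "ellipse p \<rho> u v t \<in> wall_cone (wall_at D k)"
    have 0: "N k \<bullet> (p + \<rho> *\<^sub>R c (2 * pi * t)) = 0"
      using wall[OF k(1)] pair k(2) by (auto simp: is_wall_def orth_def ell)
    have "N k \<bullet> (cos (2 * pi * t) *\<^sub>R v - sin (2 * pi * t) *\<^sub>R u) \<noteq> 0"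
      using \<rho> k(1) 0 by (auto simp: R1_def)
    then show "pairing (wall_normal (wall_at D k)) (velocity (ellipse p \<rho> u v) t) \<noteq> 0"
      using \<rho> by (simp add: velocity_ellipse[OF t] pair ellipse_velocity_def)
  qed
  moreover have "norm p < \<epsilon>" "1 < \<rho>" "\<rho> < 2" using p(1) \<rho>(1) by auto
  ultimately show ?thesis using that by blast
qed

section \<open>Laurent quotients with a negative coefficient\<close>

lemma q_root_power: "q_root ^ n = Fract (monom 1 n) 1"
proof (induction n)
  case 0
  then show ?case by (simp add: One_fract_def)
next
  case (Suc n)
  then show ?case by (simp add: q_root_def monom_Suc)
qed

lemma q_root_nonzero: "q_root \<noteq> 0"
  by (simp add: q_root_def Zero_fract_def eq_fract)

text \<open>A coincidence would make a monomial of positive degree equal to 1.\<close>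

lemma q_root_powi_inject: "q_root powi a = q_root powi b \<longleftrightarrow> a = b"
proof -
  have less: "q_root powi a \<noteq> q_root powi b" if "a < b" for a b
  proof
    assume "q_root powi a = q_root powi b"
    then have "q_root powi (b - a) = 1"
      by (simp add: power_int_diff q_root_nonzero)
    then have "q_root ^ nat (b - a) = 1" using that by (simp add: power_int_def)
    then have "monom 1 (nat (b - a)) = (1 :: rat poly)"
      by (simp add: q_root_power One_fract_def eq_fract)
    then have "degree (monom 1 (nat (b - a)) :: rat poly) = 0" by simp
    then show False using that by (simp add: degree_monom_eq)
  qed
  show ?thesis using less[of a b] less[of b a] by (cases a b rule: linorder_cases) auto
qed

lemma sum_Fract: "(\<Sum>x\<in>S. Fract (f x) 1) = Fract (sum f S) (1 :: 'a::idom)"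
  by (induction S rule: infinite_finite_induct) (auto simp: Zero_fract_def)

text \<open>
  The power series quotient of the right-hand side by the two factors on the left has lowest term
  \<open>x ^ E\<close> and a negative coefficient at \<open>x ^ (E + 2 * min d w)\<close>.
\<close>

lemma no_nonneg_quotient:
  fixes P :: "rat poly"
  assumes eq: "P * (1 - monom 1 (2 * a)) * (1 - monom 1 (2 * b)) =
      monom 1 E * (1 - monom 1 (2 * w)) * (1 - monom 1 (2 * d))"
    and nonneg: "\<And>n. 0 \<le> coeff P n" and pos: "0 < d" "0 < w" "d < a" "d < b"
  shows False
proof -
  define Q where "Q = monom 1 E * (1 - monom 1 (2 * w)) * (1 - monom 1 (2 * d) :: rat poly)"
  have Q: "Q = monom 1 E - monom 1 (E + 2 * w) - monom 1 (E + 2 * d) + monom 1 (E + 2 * w + 2 * d)"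
    by (simp add: Q_def algebra_simps mult_monom)
  \<comment> \<open>Expanding the two factors gives a recursion that expresses a coefficient of
    \<open>P\<close> by \<open>Q\<close> and by lower coefficients of \<open>P\<close>.\<close>
  have "P = Q + P * monom 1 (2 * a) + P * monom 1 (2 * b) - P * monom 1 (2 * a + 2 * b)"
    using eq by (simp add: Q algebra_simps mult_monom)
  then have "coeff P n = coeff (Q + P * monom 1 (2 * a) + P * monom 1 (2 * b) - P * monom 1 (2 * a + 2 * b)) n" for n
    by simp
  then have rec: "coeff P n = coeff Q n + (if n < 2 * a then 0 else coeff P (n - 2 * a))
      + (if n < 2 * b then 0 else coeff P (n - 2 * b))
      - (if n < 2 * a + 2 * b then 0 else coeff P (n - (2 * a + 2 * b)))" for n
    by (simp add: coeff_monom_mult mult.commute[of P])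
  have low: "coeff P n = 0" if "n < E" for n
    using that
  proof (induction n rule: less_induct)
    case (less n)
    have "coeff Q n = 0" using less.prems by (simp add: Q)
    then show ?case using less pos by (subst rec) auto
  qed
  \<comment> \<open>Since \<open>m \<le> d\<close> and \<open>d\<close> is below \<open>a\<close>
    and \<open>b\<close>, the recursion at \<open>E + 2 * m\<close> only reaches below
    \<open>E\<close>. What remains is the coefficient of \<open>Q\<close>, namely -1, or -2 if
    \<open>d = w\<close>.\<close>
  define m where "m = min d w"
  have m: "0 < m" "m < a" "m < b" using pos by (auto simp: m_def)
  have "coeff P (E + 2 * m) = coeff Q (E + 2 * m)"
    using m by (subst rec) (auto simp: low)
  also have "\<dots> < 0" using pos by (auto simp: Q m_def min_def)
  finally show False using nonneg[of "E + 2 * m"] by simp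
qed

text \<open>Splitting off \<open>- (t powi (- x))\<close> from each factor
  \<open>t powi x - t powi (- x)\<close> and multiplying by a high power of \<open>t\<close> reduces
  this to the polynomial case.\<close>

lemma no_nonneg_laurent_quotient:
  fixes c :: "'k \<Rightarrow> nat" and e :: "'k \<Rightarrow> int"
  assumes K: "finite K"
    and eq: "(\<Sum>k\<in>K. Fract [:of_nat (c k):] 1 * q_root powi e k) *
        (q_root powi a - q_root powi (- a)) * (q_root powi b - q_root powi (- b)) =
      (q_root powi w - q_root powi (- w)) * (q_root powi d - q_root powi (- d))"
    and pos: "0 < d" "0 < w" "d < a" "d < b"
  shows False
proof -
  \<comment> \<open>The sum of absolute values makes every \<open>e k + M\<close> nonnegative; the
    summand \<open>w + d\<close> does the same for the exponent \<open>M + a + b - w - d\<close> on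
    the right-hand side.\<close>
  define M where "M = (\<Sum>k\<in>K. \<bar>e k\<bar>) + w + d"
  have M: "0 \<le> e k + M" if "k \<in> K" for k
  proof -
    have "\<bar>e k\<bar> \<le> (\<Sum>k\<in>K. \<bar>e k\<bar>)" using K that by (intro member_le_sum) auto
    then show ?thesis using pos by (simp add: M_def)
  qed
  have M': "w + d \<le> M" unfolding M_def by (simp add: sum_nonneg)
  define t where "t = q_root"
  have t: "t \<noteq> 0" by (simp add: t_def q_root_nonzero)
  have fac: "t powi x - t powi (- x) = - (t powi (- x)) * (1 - t powi (2 * x))" for x
    using t by (simp add: algebra_simps power_int_add[symmetric])
  let ?S = "\<Sum>k\<in>K. Fract [:of_nat (c k):] 1 * t powi e k"
  have "?S * (- (t powi (- a)) * (1 - t powi (2 * a))) * (- (t powi (- b)) * (1 - t powi (2 * b))) =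
      (- (t powi (- w)) * (1 - t powi (2 * w))) * (- (t powi (- d)) * (1 - t powi (2 * d)))"
    using eq by (simp only: t_def[symmetric] fac[symmetric])
  then have 1: "t powi (- a) * t powi (- b) * (?S * (1 - t powi (2 * a)) * (1 - t powi (2 * b))) =
      t powi (- w) * t powi (- d) * ((1 - t powi (2 * w)) * (1 - t powi (2 * d)))"
    by (simp add: mult_ac)
  have aa: "t powi (M + a + b) * (t powi (- a) * t powi (- b)) = t powi M"
      "t powi (M + a + b) * (t powi (- w) * t powi (- d)) = t powi (M + a + b - w - d)"
    using t by (simp_all add: power_int_add[symmetric] algebra_simps)
  have "(t powi M * ?S) * (1 - t powi (2 * a)) * (1 - t powi (2 * b)) =
      t powi (M + a + b - w - d) * (1 - t powi (2 * w)) * (1 - t powi (2 * d))"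
    unfolding aa[symmetric] using arg_cong[OF 1, of "(*) (t powi (M + a + b))"]
    by (simp only: mult_ac)
  moreover have "t powi M * ?S = Fract (\<Sum>k\<in>K. monom (of_nat (c k)) (nat (e k + M))) 1"
  proof -
    have "t powi M * (Fract [:of_nat (c k):] 1 * t powi e k) = Fract (monom (of_nat (c k)) (nat (e k + M))) 1"
      if "k \<in> K" for k
    proof -
      have "t powi M * (Fract [:of_nat (c k):] 1 * t powi e k) = Fract [:of_nat (c k):] 1 * t powi (e k + M)"
        using t by (simp add: power_int_add mult_ac)
      also have "t powi (e k + M) = Fract (monom 1 (nat (e k + M))) 1"
        using M[OF that] by (simp add: power_int_def t_def q_root_power)
      finally show ?thesis by (simp add: smult_monom)
    qed
    then show ?thesis by (simp add: sum_distrib_left sum_Fract[symmetric])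
  qed
  moreover have tn: "t powi x = Fract (monom 1 (nat x)) 1" if "0 \<le> x" for x
    using that by (simp add: power_int_def t_def q_root_power)
  ultimately have "Fract ((\<Sum>k\<in>K. monom (of_nat (c k)) (nat (e k + M))) * (1 - monom 1 (nat (2 * a))) * (1 - monom 1 (nat (2 * b)))) 1 =
     Fract (monom 1 (nat (M + a + b - w - d)) * (1 - monom 1 (nat (2 * w))) * (1 - monom 1 (nat (2 * d)))) (1 :: rat poly)"
    using pos M' by (simp add: tn One_fract_def)
  then have "(\<Sum>k\<in>K. monom (of_nat (c k)) (nat (e k + M))) * (1 - monom 1 (2 * nat a)) * (1 - monom 1 (2 * nat b)) =
     monom 1 (nat (M + a + b - w - d)) * (1 - monom 1 (2 * nat w)) * (1 - monom 1 (2 * nat d) :: rat poly)"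
    by (simp add: eq_fract nat_mult_distrib)
  then show False
    by (rule no_nonneg_quotient) (use pos in \<open>auto simp: coeff_sum intro!: sum_nonneg\<close>)
qed

section \<open>The Heisenberg quotient\<close>

lemma basis_nth: "basis i $ k = (if k = i then 1 else 0)"
  by (simp add: basis_def axis_def)

lemma pairing_basis: "pairing (basis i) x = x $ i"
  by (simp add: pairing_def basis_nth if_distrib[of "\<lambda>c. of_int c * _"] cong: if_cong)

lemma pairing_add_left: "pairing (m + n) x = pairing m x + pairing n x"
  by (simp add: pairing_def sum.distrib algebra_simps)

lemma deg_basis: "deg (basis i) = 1"
  by (simp add: deg_def basis_nth)

lemma deg_add: "deg (m + n) = deg m + deg n"
  by (simp add: deg_def sum.distrib)

lemma basis_eq_multiple:
  assumes "basis i = int m *s n"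
  shows "m = 1" "n = basis i"
proof -
  have "int m * n $ i = 1" using arg_cong[OF assms, of "\<lambda>x. x $ i"] by (simp add: basis_nth)
  then show "m = 1" using zmult_eq_1_iff by force
  then show "n = basis i" using assms by simp
qed

lemma basis_add_eq_multiple:
  assumes "basis i + basis j = int m *s n" "i \<noteq> j"
  shows "m = 1" "n = basis i + basis j"
proof -
  have "int m * n $ i = 1" using arg_cong[OF assms(1), of "\<lambda>x. x $ i"] assms(2) by (simp add: basis_nth)
  then show "m = 1" using zmult_eq_1_iff by force
  then show "n = basis i + basis j" using assms by simp
qed

text \<open>Both parts are nonnegative and of positive degree, so each takes exactly one of the two
  unit coordinates. The Lie bracket thus has only two terms here.\<close>

lemma N_plus_splittings:
  assumes "i \<noteq> j"
  shows "{(a, b). a \<in> N_plus \<and> b \<in> N_plus \<and> a + b = basis i + basis j} =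
    {(basis i, basis j), (basis j, basis i)}" (is "?L = ?R")
proof
  show "?R \<subseteq> ?L" by (auto simp: N_plus_def deg_basis basis_nth)
  show "?L \<subseteq> ?R"
  proof
    fix z assume "z \<in> ?L"
    then obtain a b where z: "z = (a, b)" "a \<in> N_plus" "b \<in> N_plus" "a + b = basis i + basis j"
      by (cases z) auto
    have nonneg: "0 \<le> a $ k" "0 \<le> b $ k" for k using z by (auto simp: N_plus_def)
    have s: "a $ k + b $ k = (if k = i then 1 else 0) + (if k = j then 1 else 0)" for k
      using arg_cong[OF z(4), of "\<lambda>x. x $ k"] by (simp add: basis_nth)
    have other: "a $ k = 0" "b $ k = 0" if "k \<noteq> i" "k \<noteq> j" for k
      using s[of k] nonneg[of k] that by auto
    have da: "deg x = x $ i + x $ j" if "\<And>k. k \<noteq> i \<Longrightarrow> k \<noteq> j \<Longrightarrow> x $ k = 0" for x :: "int ^ 'a"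
    proof -
      have "deg x = sum (($) x) {i, j}"
        unfolding deg_def by (rule sum.mono_neutral_right) (use that in auto)
      then show ?thesis using assms by simp
    qed
    have "0 < a $ i + a $ j" "0 < b $ i + b $ j"
      using z(2,3) da[of a] da[of b] other by (auto simp: N_plus_def)
    moreover have "a $ i + b $ i = 1" "a $ j + b $ j = 1" using s[of i] s[of j] assms by auto
    ultimately consider "a $ i = 1" "a $ j = 0" "b $ i = 0" "b $ j = 1"
      | "a $ i = 0" "a $ j = 1" "b $ i = 1" "b $ j = 0"
      using nonneg[of i] nonneg[of j] by linarith
    then show "z \<in> ?R"
    proof cases
      case 1
      then have "a = basis i" "b = basis j" using other assms by (simp_all add: vec_eq_iff basis_nth) metis+
      then show ?thesis using z by simp
    next
      case 2
      then have "a = basis j" "b = basis i" using other assms by (simp_all add: vec_eq_iff basis_nth) metis+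
      then show ?thesis using z by simp
    qed
  qed
qed

context seed_data
begin

lemma q_number_minus: "q_number (- \<alpha>) = - q_number \<alpha>"
  by (simp add: q_number_def minus_divide_left)

lemma length_le_dynkin_length: "\<forall>(r, s)\<in>set ps. 0 < r + s \<Longrightarrow> length ps \<le> dynkin_length ps"
  by (induction ps) (force simp: dynkin_length_def)+

text \<open>Every pair contributes at least 1 to \<open>dynkin_length\<close>, which also bounds the
  length of the list. This and the next list are the terms of the Baker-Campbell-Hausdorff series up
  to degree 1 and 2.\<close>

lemma dynkin_indices_1:
  "{ps. ps \<noteq> [] \<and> (\<forall>(r, s)\<in>set ps. 0 < r + s) \<and> int (dynkin_length ps) \<le> 1} = {[(1, 0)], [(0, 1)]}"
  (is "?L = ?R")
proof
  show "?R \<subseteq> ?L" by (auto simp: dynkin_length_def)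
  show "?L \<subseteq> ?R"
  proof
    fix ps assume ps: "ps \<in> ?L"
    then have "length ps \<le> 1" using length_le_dynkin_length[of ps] by simp
    then obtain r s where "ps = [(r, s)]" using ps by (cases ps) auto
    then show "ps \<in> ?R" using ps by (auto simp: dynkin_length_def)
  qed
qed

lemma dynkin_indices_2:
  "{ps. ps \<noteq> [] \<and> (\<forall>(r, s)\<in>set ps. 0 < r + s) \<and> int (dynkin_length ps) \<le> 2} =
    {[(1, 0)], [(0, 1)], [(2, 0)], [(1, 1)], [(0, 2)],
     [(1, 0), (1, 0)], [(1, 0), (0, 1)], [(0, 1), (1, 0)], [(0, 1), (0, 1)]}"
  (is "?L = ?R")
proof
  show "?R \<subseteq> ?L" by (auto simp: dynkin_length_def)
  show "?L \<subseteq> ?R"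
  proof
    fix ps assume ps: "ps \<in> ?L"
    then have "length ps \<le> 2" using length_le_dynkin_length[of ps] by simp
    then consider r s where "ps = [(r, s)]" | r s r' s' where "ps = [(r, s), (r', s')]"
      using ps by (cases ps; cases "tl ps") auto
    then show "ps \<in> ?R"
    proof cases
      case 1
      then have "0 < r + s" "r + s \<le> 2" using ps by (auto simp: dynkin_length_def)
      then have "(r, s) \<in> {(1, 0), (0, 1), (2, 0), (1, 1), (0, 2)}" by auto
      then show ?thesis using 1 by auto
    next
      case 2
      then have "0 < r + s" "0 < r' + s'" "r + s + (r' + s') \<le> 2" using ps by (auto simp: dynkin_length_def)
      then have "(r, s) \<in> {(1, 0), (0, 1)}" "(r', s') \<in> {(1, 0), (0, 1)}" by auto
      then show ?thesis using 2 by auto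
    qed
  qed
qed

lemma G_mult_basis: "G_mult x y (basis i) = x (basis i) + y (basis i)"
proof -
  have "G_mult x y (basis i) = (\<Sum>ps\<in>{[(1, 0)], [(0, 1)]}. dynkin_coeff ps * dynkin_bracket x y ps (basis i))"
    by (simp only: G_mult_def deg_basis dynkin_indices_1)
  then show ?thesis by (simp add: dynkin_coeff_def dynkin_bracket_def dynkin_length_def)
qed

lemma bracket_basis_add:
  assumes "i \<noteq> j"
  shows "bracket x y (basis i + basis j) =
    (x (basis i) * y (basis j) - x (basis j) * y (basis i)) * q_number (form (basis i) (basis j))"
proof -
  have "(basis i, basis j) \<noteq> (basis j, basis i :: int ^ 'r)"
    using assms by (metis basis_nth prod.inject zero_neq_one)
  then have "bracket x y (basis i + basis j) =
     x (basis i) * y (basis j) * q_number (form (basis i) (basis j)) +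
     x (basis j) * y (basis i) * q_number (form (basis j) (basis i))"
    by (simp add: bracket_def N_plus_splittings[OF assms])
  also have "form (basis j) (basis i) = - form (basis i) (basis j)" by (rule form_skew)
  finally show ?thesis by (simp add: q_number_minus algebra_simps)
qed

text \<open>Brackets of an element with itself vanish here. The coefficient of
  \<open>bracket x y\<close> is 1/2 from \<open>[(1, 1)]\<close>, minus 1/4 from
  \<open>[(1, 0), (0, 1)]\<close>, plus 1/4 from the reversed list: the group law of a Heisenberg
  group.\<close>

lemma G_mult_basis_add:
  assumes "i \<noteq> j"
  shows "G_mult x y (basis i + basis j) = x (basis i + basis j) + y (basis i + basis j) +
    (x (basis i) * y (basis j) - x (basis j) * y (basis i)) * q_number (form (basis i) (basis j)) / 2"
proof -
  have "deg (basis i + basis j :: int ^ 'r) = 2" by (simp add: deg_add deg_basis)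
  then have "G_mult x y (basis i + basis j) = (\<Sum>ps\<in>{[(1, 0)], [(0, 1)], [(2, 0)], [(1, 1)], [(0, 2)],
     [(1, 0), (1, 0)], [(1, 0), (0, 1)], [(0, 1), (1, 0)], [(0, 1), (0, 1)]}.
     dynkin_coeff ps * dynkin_bracket x y ps (basis i + basis j))"
    by (simp only: G_mult_def dynkin_indices_2)
  then show ?thesis
    by (simp add: dynkin_coeff_def dynkin_bracket_def dynkin_length_def numeral_2_eq_2
        bracket_basis_add[OF assms] field_simps)
qed

end

text \<open>A wall element is supported on positive multiples of the wall normal, and
  \<open>basis i\<close> is primitive.\<close>

lemma wall_elt_basis:
  assumes "is_wall w" "wall_elt w (basis i) \<noteq> 0"
  shows "wall_normal w = basis i"
proof -
  obtain m where "basis i = int m *s wall_normal w"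
    using assms by (auto simp: is_wall_def G_par_def)
  then show ?thesis using basis_eq_multiple(2) by metis
qed

lemma wall_elt_basis_add:
  assumes "is_wall w" "wall_elt w (basis i + basis j) \<noteq> 0" "i \<noteq> j"
  shows "wall_normal w = basis i + basis j"
proof -
  obtain m where "basis i + basis j = int m *s wall_normal w"
    using assms(1,2) by (auto simp: is_wall_def G_par_def)
  then show ?thesis using basis_add_eq_multiple(2) assms(3) by metis
qed

context seed_data
begin
text \<open>
  The coordinate \<open>c + a b w / 2\<close> of the Heisenberg quotient with entries \<open>a, b, c\<close> at \<open>e\<^sub>i\<close>,
  \<open>e\<^sub>j\<close>, \<open>e\<^sub>i + e\<^sub>j\<close> makes the cocycle of the product one-sided.
\<close>

lemma ordered_product_coeffs:
  fixes g :: "real \<times> 'k \<Rightarrow> 'r lie" and cs :: "(real \<times> 'k) list"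
  assumes "i \<noteq> j" "distinct cs" "sorted (map fst cs)"
    and "\<forall>x\<in>set cs. \<forall>y\<in>set cs. fst x = fst y \<longrightarrow> g x (basis i) * g y (basis j) = 0"
  defines "P \<equiv> fold (\<lambda>c h. G_mult (g c) h) cs G_one" and "w \<equiv> q_number (form (basis i) (basis j))"
  shows "P (basis i) = (\<Sum>x\<in>set cs. g x (basis i))"
    and "P (basis j) = (\<Sum>x\<in>set cs. g x (basis j))"
    and "P (basis i + basis j) + w / 2 * P (basis i) * P (basis j) =
      (\<Sum>x\<in>set cs. g x (basis i + basis j)) +
      w * (\<Sum>x\<in>set cs. g x (basis i) * (\<Sum>y | y \<in> set cs \<and> fst y < fst x. g y (basis j)))"
  using assms(2-4) unfolding P_def
proof (induction cs rule: rev_induct)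
  case Nil
  { case 1 show ?case by (simp add: G_one_def)
  next case 2 show ?case by (simp add: G_one_def)
  next case 3 show ?case by (simp add: G_one_def) }
next
  case (snoc x cs)
  define Q where "Q = fold (\<lambda>c h. G_mult (g c) h) cs G_one"
  have fold: "fold (\<lambda>c h. G_mult (g c) h) (cs @ [x]) G_one = G_mult (g x) Q" by (simp add: Q_def)
  have IH: "Q (basis i) = (\<Sum>x\<in>set cs. g x (basis i))" "Q (basis j) = (\<Sum>x\<in>set cs. g x (basis j))"
    "Q (basis i + basis j) + w / 2 * Q (basis i) * Q (basis j) =
      (\<Sum>x\<in>set cs. g x (basis i + basis j)) +
      w * (\<Sum>x\<in>set cs. g x (basis i) * (\<Sum>y | y \<in> set cs \<and> fst y < fst x. g y (basis j)))"
    if "distinct (cs @ [x])" "sorted (map fst (cs @ [x]))"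
      "\<forall>x'\<in>set (cs @ [x]). \<forall>y\<in>set (cs @ [x]). fst x' = fst y \<longrightarrow> g x' (basis i) * g y (basis j) = 0"
    unfolding Q_def by (rule snoc.IH; use that in \<open>simp add: sorted_append\<close>)+
  { case 1
    then show ?case using IH(1) by (simp add: fold G_mult_basis del: fold_append)
  next
    case 2
    then show ?case using IH(2) by (simp add: fold G_mult_basis del: fold_append)
  next
    case 3
    note prems = 3
    have x: "x \<notin> set cs" using prems(1) by simp
    have sorted: "fst y \<le> fst x" if "y \<in> set cs" for y using prems(2) that by (auto simp: sorted_append)
    have gx: "g x (basis i) * g x (basis j) = 0" using prems(3) by simp
    \<comment> \<open>\<open>x\<close> comes last, so it is strictly earlier than nothing and enters
      none of the inner sums.\<close>
    have 1: "(\<Sum>y | y \<in> set (cs @ [x]) \<and> fst y < fst z. g y (basis j)) =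
        (\<Sum>y | y \<in> set cs \<and> fst y < fst z. g y (basis j))" if "z \<in> set (cs @ [x])" for z
    proof (rule sum.cong)
      have "fst z \<le> fst x" using sorted[of z] that by auto
      then show "{y. y \<in> set (cs @ [x]) \<and> fst y < fst z} = {y. y \<in> set cs \<and> fst y < fst z}" by auto
    qed simp
    \<comment> \<open>The sum may be restricted to strictly earlier times because simultaneous
      entries multiply to 0 by assumption.\<close>
    have "g x (basis i) * Q (basis j) = (\<Sum>y\<in>set cs. g x (basis i) * g y (basis j))"
      using IH(2)[OF prems] by (simp add: sum_distrib_left)
    also have "\<dots> = (\<Sum>y | y \<in> set cs \<and> fst y < fst x. g x (basis i) * g y (basis j))"
    proof (rule sum.mono_neutral_right)
      show "\<forall>y\<in>set cs - {y \<in> set cs. fst y < fst x}. g x (basis i) * g y (basis j) = 0"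
      proof
        fix y assume "y \<in> set cs - {y \<in> set cs. fst y < fst x}"
        then have "y \<in> set cs" "fst x = fst y" using sorted[of y] by auto
        then show "g x (basis i) * g y (basis j) = 0" using prems(3) by simp
      qed
    qed auto
    finally have 2: "g x (basis i) * Q (basis j) =
        g x (basis i) * (\<Sum>y | y \<in> set cs \<and> fst y < fst x. g y (basis j))"
      by (simp add: sum_distrib_left)
    have "(\<Sum>z\<in>set (cs @ [x]). g z (basis i) * (\<Sum>y | y \<in> set (cs @ [x]) \<and> fst y < fst z. g y (basis j))) =
       (\<Sum>z\<in>set (cs @ [x]). g z (basis i) * (\<Sum>y | y \<in> set cs \<and> fst y < fst z. g y (basis j)))"
      using 1 by (intro sum.cong) auto
    also have "\<dots> = g x (basis i) * Q (basis j) +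
       (\<Sum>z\<in>set cs. g z (basis i) * (\<Sum>y | y \<in> set cs \<and> fst y < fst z. g y (basis j)))"
      using x by (simp add: 2)
    finally have 3: "(\<Sum>z\<in>set (cs @ [x]). g z (basis i) * (\<Sum>y | y \<in> set (cs @ [x]) \<and> fst y < fst z. g y (basis j))) = \<dots>" .
    have 4: "(\<Sum>x\<in>set (cs @ [x]). g x (basis i + basis j)) =
        g x (basis i + basis j) + (\<Sum>x\<in>set cs. g x (basis i + basis j))"
      using x by simp
    \<comment> \<open>Of the two mixed products in the commutator, the term with
      \<open>w / 2\<close> doubles \<open>g x (basis i) * Q (basis j)\<close> and cancels the
      other.\<close>
    have "G_mult (g x) Q (basis i + basis j) + w / 2 * G_mult (g x) Q (basis i) * G_mult (g x) Q (basis j) =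
      g x (basis i + basis j) + w / 2 * (g x (basis i) * g x (basis j)) + w * (g x (basis i) * Q (basis j)) +
      (Q (basis i + basis j) + w / 2 * Q (basis i) * Q (basis j))"
      by (simp add: G_mult_basis G_mult_basis_add[OF assms(1)] w_def[symmetric] field_simps)
    then show ?case
      unfolding fold 3 4 IH(3)[OF prems] gx by (simp add: algebra_simps) }
qed

end

section \<open>Quantum numbers and wall elements\<close>

lemma floor_minus_of_nat: "\<lfloor>- rat_of_nat m\<rfloor> = - int m"
  by (metis floor_of_int of_int_minus of_int_of_nat_eq)

context seed_data
begin
lemma \<delta>_dvd_\<delta>\<^sub>0: "\<delta> i dvd \<delta>\<^sub>0"
  by (simp add: \<delta>\<^sub>0_def dvd_Lcm)

lemma \<delta>\<^sub>0_pos: "0 < \<delta>\<^sub>0"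
  unfolding \<delta>\<^sub>0_def using \<delta>_pos by (metis Lcm_0_iff finite finite_imageI gr_zeroI imageE less_irrefl)

lemma form_scale_left: "form (int m *s x) y = of_nat m * form x y"
proof (induction m)
  case 0
  have "form 0 y = 0" using form_add_left[of 0 0 y] by simp
  then show ?case by (simp add: vec_eq_iff zero_vec_def[symmetric])
next
  case (Suc m)
  have "int (Suc m) *s x = x + int m *s x" by (simp add: vec_eq_iff algebra_simps)
  then show ?case using Suc by (simp add: form_add_left algebra_simps)
qed

lemma exchange_matrix_eq: "exchange_matrix i j = of_nat (\<delta> i) * form (basis i) (basis j)"
  by (simp add: exchange_matrix_def form_scale_left)

lemma exchange_matrix_integral: "exchange_matrix i j \<in> \<int>"
  unfolding exchange_matrix_def by (rule form_integral) (simp add: basis_nth)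

text \<open>The product is an integer multiple of an exchange matrix entry. Hence the floor in
  \<open>q_power\<close> is exact at this value of the form.\<close>

lemma \<delta>\<^sub>0_form_integral: "of_nat \<delta>\<^sub>0 * form (basis i) (basis j) \<in> \<int>"
proof -
  obtain m where "\<delta>\<^sub>0 = \<delta> i * m" using \<delta>_dvd_\<delta>\<^sub>0 by blast
  then have "of_nat \<delta>\<^sub>0 * form (basis i) (basis j) = of_nat m * exchange_matrix i j"
    by (simp add: exchange_matrix_eq)
  then show ?thesis using exchange_matrix_integral by simp
qed

lemma q_number_integral:
  assumes "of_nat \<delta>\<^sub>0 * \<alpha> = of_int z"
  shows "q_number \<alpha> = (q_root powi z - q_root powi (- z)) / (q_root powi \<delta>\<^sub>0 - q_root powi (- \<delta>\<^sub>0))"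
proof -
  have "of_nat \<delta>\<^sub>0 * (- \<alpha>) = of_int (- z)" using assms by simp
  then have "\<lfloor>of_nat \<delta>\<^sub>0 * (- \<alpha>)\<rfloor> = - z" by (metis floor_of_int)
  then show ?thesis using assms by (simp add: q_number_def q_power_def floor_minus_of_nat)
qed

lemma q_denominator_nonzero: "q_root powi \<delta>\<^sub>0 - q_root powi (- \<delta>\<^sub>0) \<noteq> 0"
  using \<delta>\<^sub>0_pos q_root_powi_inject[of "int \<delta>\<^sub>0" "- int \<delta>\<^sub>0"] by simp

lemma q_power_nonzero: "q_power \<alpha> \<noteq> 0"
  by (simp add: q_power_def q_root_nonzero)

text \<open>The floors in \<open>q_power \<alpha>\<close> and \<open>q_power (- \<alpha>)\<close>
  have opposite signs, so the powers differ. In this form it applies to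
  \<open>1 / \<delta>_of n\<close> by an estimate of \<open>\<delta>_of n\<close> alone.\<close>

lemma q_number_nonzero:
  assumes "1 \<le> of_nat \<delta>\<^sub>0 * \<alpha>"
  shows "q_number \<alpha> \<noteq> 0"
proof -
  have "1 \<le> \<lfloor>of_nat \<delta>\<^sub>0 * \<alpha>\<rfloor>" "\<lfloor>of_nat \<delta>\<^sub>0 * (- \<alpha>)\<rfloor> < 0" using assms by auto
  then have "q_power \<alpha> \<noteq> q_power (- \<alpha>)" unfolding q_power_def q_root_powi_inject by linarith
  moreover have "\<lfloor>of_nat \<delta>\<^sub>0 * (1::rat)\<rfloor> \<noteq> \<lfloor>of_nat \<delta>\<^sub>0 * (- 1::rat)\<rfloor>"
    using \<delta>\<^sub>0_pos by (simp add: floor_minus_of_nat)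
  then have "q_power 1 \<noteq> q_power (- 1)" unfolding q_power_def q_root_powi_inject .
  ultimately show ?thesis by (simp add: q_number_def)
qed

lemma q_number_inverse_\<delta>_nonzero: "q_number (1 / of_nat (\<delta> i)) \<noteq> 0"
proof (rule q_number_nonzero)
  have "\<delta> i \<le> \<delta>\<^sub>0" using \<delta>_dvd_\<delta>\<^sub>0 \<delta>\<^sub>0_pos by (simp add: dvd_imp_le)
  then have "(of_nat (\<delta> i) :: rat) \<le> of_nat \<delta>\<^sub>0" by (simp only: of_nat_le_iff)
  then show "1 \<le> of_nat \<delta>\<^sub>0 * (1 / of_nat (\<delta> i) :: rat)"
    using \<delta>_pos[of i] by (simp add: field_simps)
qed

text \<open>The minimum over rationals exists because it can be read off in a coordinate
  \<open>k\<close> with \<open>0 < n $ k\<close>: every admissible \<open>s\<close> makes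
  \<open>s * n $ k\<close> a natural number. The upper bound holds because
  \<open>\<delta>\<^sub>0\<close> is admissible.\<close>

lemma \<delta>_of_bounds:
  assumes "n \<in> N_plus"
  shows "0 < \<delta>_of n" "\<delta>_of n \<le> of_nat \<delta>\<^sub>0"
proof -
  define P where "P s \<longleftrightarrow> 0 < s \<and> (\<exists>m\<in>N_circ. \<forall>i. of_int (m $ i) = s * of_int (n $ i))" for s :: rat
  have "\<exists>k. n $ k \<noteq> 0"
  proof (rule ccontr)
    assume "\<nexists>k. n $ k \<noteq> 0"
    then have "deg n = 0" by (simp add: deg_def)
    then show False using assms by (simp add: N_plus_def)
  qed
  then obtain k where k: "0 < n $ k" using assms by (auto simp: N_plus_def order_less_le)
  have P0: "P (of_nat \<delta>\<^sub>0)"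
    unfolding P_def N_circ_def using \<delta>\<^sub>0_pos \<delta>_dvd_\<delta>\<^sub>0
    by (auto intro!: exI[of _ "int \<delta>\<^sub>0 *s n"] dvd_mult2)
  have nat: "\<exists>a::nat. s * of_int (n $ k) = of_nat a" if s: "P s" for s
  proof -
    obtain m where m: "of_int (m $ k) = s * of_int (n $ k)" using s by (auto simp: P_def)
    have "0 < s * of_int (n $ k)" using s k by (simp add: P_def)
    then have "0 < m $ k" by (simp only: m[symmetric] of_int_0_less_iff)
    then have "of_nat (nat (m $ k)) = (of_int (m $ k) :: rat)" by simp
    then show ?thesis using m by metis
  qed
  define a where "a = (LEAST a::nat. \<exists>s. P s \<and> s * of_int (n $ k) = of_nat a)"
  have "\<exists>a::nat. \<exists>s. P s \<and> s * of_int (n $ k) = of_nat a" using nat P0 by blast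
  then have "\<exists>s. P s \<and> s * of_int (n $ k) = of_nat a"
    unfolding a_def by (rule LeastI_ex)
  then obtain s where s: "P s" "s * of_int (n $ k) = of_nat a" by blast
  have le: "s \<le> s'" if s': "P s'" for s'
  proof -
    obtain a' where a': "s' * of_int (n $ k) = of_nat a'" using nat[OF s'] by blast
    then have "a \<le> a'" unfolding a_def using s' by (intro Least_le) blast
    then have "s * of_int (n $ k) \<le> s' * of_int (n $ k)" by (simp add: s(2) a')
    then show ?thesis using k by simp
  qed
  have "\<delta>_of n = s"
    unfolding \<delta>_of_def P_def[symmetric] using s(1) le by (rule Least_equality)
  then show "0 < \<delta>_of n" "\<delta>_of n \<le> of_nat \<delta>\<^sub>0" using s(1) le[OF P0] by (auto simp: P_def)
qed

text \<open>Both nonzero coordinates of an admissible multiple equal the scaling factor, which is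
  therefore an integer divisible by \<open>\<delta> i\<close> and \<open>\<delta> j\<close>.\<close>

lemma \<delta>_of_basis_add:
  assumes "i \<noteq> j"
  shows "\<delta>_of (basis i + basis j) = of_nat (lcm (\<delta> i) (\<delta> j))"
  unfolding \<delta>_of_def
proof (rule Least_equality)
  let ?L = "lcm (\<delta> i) (\<delta> j)"
  have "0 < ?L" using \<delta>_pos by (simp add: lcm_pos_nat)
  moreover have "int ?L *s (basis i + basis j) \<in> N_circ"
    by (auto simp: N_circ_def basis_nth)
  ultimately show "0 < (of_nat ?L :: rat) \<and>
      (\<exists>m\<in>N_circ. \<forall>k. of_int (m $ k) = of_nat ?L * (of_int ((basis i + basis j) $ k) :: rat))"
    by (intro conjI bexI[of _ "int ?L *s (basis i + basis j)"]) (simp_all add: algebra_simps)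
  fix s :: rat
  assume "0 < s \<and> (\<exists>m\<in>N_circ. \<forall>k. of_int (m $ k) = s * of_int ((basis i + basis j) $ k))"
  then obtain m where m: "0 < s" "m \<in> N_circ" "\<And>k. of_int (m $ k) = s * of_int ((basis i + basis j) $ k)"
    by blast
  have mi: "of_int (m $ i) = s" "of_int (m $ j) = s"
    using m(3)[of i] m(3)[of j] assms by (simp_all add: basis_nth)
  then have "m $ i = m $ j" "0 < m $ i" using m(1) by (metis of_int_eq_iff, metis of_int_0_less_iff)
  moreover have "int (\<delta> i) dvd m $ i" "int (\<delta> j) dvd m $ j" using m(2) by (auto simp: N_circ_def)
  ultimately have "lcm (int (\<delta> i)) (int (\<delta> j)) dvd m $ i" by (metis lcm_least)
  then have "int ?L \<le> m $ i" using \<open>0 < m $ i\<close> by (simp add: zdvd_imp_le lcm_int_int_eq)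
  then show "of_nat ?L \<le> s" using mi(1) by (metis of_int_le_iff of_int_of_nat_eq)
qed

lemma \<Psi>_self:
  assumes "n \<noteq> 0"
  shows "\<Psi> a b n n = q_power b / q_number a"
proof -
  obtain k where k: "n $ k \<noteq> 0" using assms by (auto simp: vec_eq_iff)
  have "j = 1" if "n = int j *s n" for j
    using arg_cong[OF that, of "\<lambda>x. x $ k"] k by simp
  then have "{j::nat. 1 \<le> j \<and> n = int j *s n} = {1}" by (auto simp: vec_eq_iff)
  then show ?thesis by (simp add: \<Psi>_def)
qed

lemma \<Psi>_basis_add:
  assumes "i \<noteq> j" "\<Psi> a b n (basis i + basis j) \<noteq> 0"
  shows "n = basis i + basis j"
proof (rule ccontr)
  assume "n \<noteq> basis i + basis j"
  then have "{m::nat. 1 \<le> m \<and> basis i + basis j = int m *s n} = {}"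
    using basis_add_eq_multiple(2)[OF _ assms(1)] by auto
  then show False using assms(2) unfolding \<Psi>_def by (simp only: sum.empty)
qed

text \<open>Each wall element has a nonzero coefficient at some \<open>n\<close>, so its wall occurs
  among the finitely many that are nontrivial modulo \<open>G_gt l\<close> with
  \<open>l = deg n\<close>. The choice of a generic loop relies on this.\<close>

lemma positive_realization_countable:
  assumes "positive_realization D"
  shows "countable (index D)"
proof -
  have "index D \<subseteq> (\<Union>l. {k \<in> index D. wall_elt (wall_at D k) \<notin> G_gt l})"
  proof
    fix k assume k: "k \<in> index D"
    then obtain n b c where n: "n \<in> N_plus" "0 < (c::nat)"
      "wall_elt (wall_at D k) = G_pow (\<Psi> (1 / \<delta>_of n) b n) (of_nat c)"
      using assms unfolding positive_realization_def by blast
    have "n \<noteq> 0" using n(1) by (auto simp: N_plus_def deg_def)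
    have "q_number (1 / \<delta>_of n) \<noteq> 0"
      using \<delta>_of_bounds[OF n(1)] by (intro q_number_nonzero) (simp add: field_simps)
    moreover have "Fract [:rat_of_nat c:] 1 \<noteq> 0" using n(2) by (simp add: Zero_fract_def eq_fract)
    ultimately have "wall_elt (wall_at D k) n \<noteq> 0"
      using \<open>n \<noteq> 0\<close> by (simp add: n(3) G_pow_def \<Psi>_self q_power_nonzero)
    then have "wall_elt (wall_at D k) \<notin> G_gt (nat (deg n))"
      using n(1) by (auto simp: G_gt_def N_plus_def)
    then show "k \<in> (\<Union>l. {k \<in> index D. wall_elt (wall_at D k) \<notin> G_gt l})" using k by blast
  qed
  moreover have "countable (\<Union>l. {k \<in> index D. wall_elt (wall_at D k) \<notin> G_gt l})"
    using assms by (intro countable_UN)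
      (auto simp: positive_realization_def QCSD_def scattering_diagram_def intro: countable_finite)
  ultimately show ?thesis by (rule countable_subset)
qed

end

section \<open>The loop around the codimension 2 joint\<close>

text \<open>These turn signs of sine and cosine into the order of crossings along the loop. The
  reflection \<open>2 * pi - \<theta>\<close> reduces the lower half circle to the upper
  one.\<close>

lemma quadrant_time:
  fixes t :: real
  assumes "0 \<le> t" "t \<le> 1"
  shows "0 < sin (2 * pi * t) \<Longrightarrow> 0 < cos (2 * pi * t) \<Longrightarrow> t < 1 / 4"
    and "0 < sin (2 * pi * t) \<Longrightarrow> cos (2 * pi * t) < 0 \<Longrightarrow> 1 / 4 < t \<and> t < 1 / 2"
    and "sin (2 * pi * t) < 0 \<Longrightarrow> cos (2 * pi * t) < 0 \<Longrightarrow> 1 / 2 < t \<and> t < 3 / 4"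
    and "sin (2 * pi * t) < 0 \<Longrightarrow> 0 < cos (2 * pi * t) \<Longrightarrow> 3 / 4 < t"
proof -
  define \<theta> where "\<theta> = 2 * pi * t"
  have \<theta>: "0 \<le> \<theta>" "\<theta> \<le> 2 * pi" using assms by (simp_all add: \<theta>_def)
  have s: "0 < sin \<theta> \<Longrightarrow> \<theta> < pi" "sin \<theta> < 0 \<Longrightarrow> pi < \<theta>"
    using \<theta> sin_le_zero[of \<theta>] sin_ge_zero[of \<theta>] by (force simp: not_less le_less)+
  have c1: "x < pi / 2" if "0 < cos x" "0 \<le> x" "x \<le> pi" for x
    using cos_monotone_0_pi_le[of "pi / 2" x] that by (force simp: not_less)
  have c2: "pi / 2 < x" if "cos x < 0" "0 \<le> x" for x
    using cos_ge_zero[of x] that by (force simp: not_less)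
  have c: "cos (2 * pi - \<theta>) = cos \<theta>" by (simp add: cos_diff)
  have t: "t < r \<longleftrightarrow> \<theta> < 2 * pi * r" "r < t \<longleftrightarrow> 2 * pi * r < \<theta>" for r
    by (simp_all add: \<theta>_def)
  show "0 < sin (2 * pi * t) \<Longrightarrow> 0 < cos (2 * pi * t) \<Longrightarrow> t < 1 / 4"
    using s c1[of \<theta>] \<theta> unfolding t \<theta>_def[symmetric] by simp
  show "0 < sin (2 * pi * t) \<Longrightarrow> cos (2 * pi * t) < 0 \<Longrightarrow> 1 / 4 < t \<and> t < 1 / 2"
    using s c2[of \<theta>] \<theta> unfolding t \<theta>_def[symmetric] by simp
  show "sin (2 * pi * t) < 0 \<Longrightarrow> cos (2 * pi * t) < 0 \<Longrightarrow> 1 / 2 < t \<and> t < 3 / 4"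
    using s c2[of "2 * pi - \<theta>"] \<theta> c unfolding t \<theta>_def[symmetric] by simp
  show "sin (2 * pi * t) < 0 \<Longrightarrow> 0 < cos (2 * pi * t) \<Longrightarrow> 3 / 4 < t"
    using s c1[of "2 * pi - \<theta>"] \<theta> c unfolding t \<theta>_def[symmetric] by simp
qed

text \<open>The squares of \<open>s + c\<close> and \<open>s - c\<close> add up to 2, those of
  \<open>s\<close> and \<open>c\<close> to 1, so if one of a pair is small, the other is
  not.\<close>

lemma unit_circle_bounds:
  fixes s c :: real
  assumes "s\<^sup>2 + c\<^sup>2 = 1"
  shows "\<bar>s - c\<bar> \<le> 1 / 10 \<Longrightarrow> 1 \<le> \<bar>s + c\<bar>"
    and "\<bar>s + c\<bar> \<le> 1 / 10 \<Longrightarrow> 1 \<le> \<bar>s - c\<bar>"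
    and "\<bar>c\<bar> \<le> 1 / 10 \<Longrightarrow> 1 / 2 \<le> \<bar>s\<bar>"
proof -
  have sq: "(s + c)\<^sup>2 + (s - c)\<^sup>2 = 2" using assms by (simp add: power2_eq_square algebra_simps)
  have small: "x\<^sup>2 \<le> 1 / 100" if "\<bar>x\<bar> \<le> 1 / 10" for x :: real
    using power_mono[OF that, of 2] by (simp add: power2_eq_square)
  have large: "r \<le> \<bar>x\<bar>" if "r\<^sup>2 \<le> x\<^sup>2" "0 \<le> r" for x r :: real
    using that by (simp add: abs_le_square_iff[symmetric])
  show "\<bar>s - c\<bar> \<le> 1 / 10 \<Longrightarrow> 1 \<le> \<bar>s + c\<bar>"
    using small[of "s - c"] sq by (intro large) auto
  show "\<bar>s + c\<bar> \<le> 1 / 10 \<Longrightarrow> 1 \<le> \<bar>s - c\<bar>"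
    using small[of "s + c"] sq by (intro large) auto
  show "\<bar>c\<bar> \<le> 1 / 10 \<Longrightarrow> 1 / 2 \<le> \<bar>s\<bar>"
    using small[of c] assms by (intro large) (auto simp: power_divide)
qed

lemma cos_time_inject:
  assumes "0 \<le> t" "t \<le> 1 / 2" "0 \<le> t'" "t' \<le> 1 / 2" "cos (2 * pi * t) = cos (2 * pi * t')"
  shows "t = t'"
proof -
  have "2 * pi * t \<le> 2 * pi * (1 / 2)" "2 * pi * t' \<le> 2 * pi * (1 / 2)"
    using assms by (intro mult_left_mono; simp)+
  then have le: "2 * pi * t \<le> pi" "2 * pi * t' \<le> pi" by simp_all
  have "0 \<le> 2 * pi * t" "0 \<le> 2 * pi * t'" using assms(1,3) by simp_all
  then have "2 * pi * t = 2 * pi * t'" using cos_inj_pi[of "2 * pi * t" "2 * pi * t'"] le assms(5) by blast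
  then show ?thesis by simp
qed

lemma crossing_elt_eq:
  "crossing_elt D \<gamma> (t, k) n =
    (if pairing (wall_normal (wall_at D k)) (velocity \<gamma> t) < 0
     then wall_elt (wall_at D k) n else - wall_elt (wall_at D k) n)"
proof -
  have "Fract [:1::rat:] 1 = 1" "Fract [:- 1::rat:] 1 = - 1"
    by (simp_all add: One_fract_def one_pCons)
  then show ?thesis by (simp add: crossing_elt_def G_pow_def)
qed

context seed_data
begin

text \<open>Modulo \<open>G_gt l\<close> finitely many walls remain, and their cones are closed.
  Each non-incoming one misses a ball around \<open>p_star\<close> of its normal; the smallest
  radius serves all.\<close>

lemma scattering_diagram_far_cones:
  assumes "scattering_diagram D"
  obtains \<eta> where "0 < \<eta>"
    "\<And>k y. k \<in> index D \<Longrightarrow> wall_elt (wall_at D k) \<notin> G_gt l \<Longrightarrow> \<not> incoming (wall_at D k) \<Longrightarrow>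
      norm (y - p_star (wall_normal (wall_at D k))) < \<eta> \<Longrightarrow> y \<notin> wall_cone (wall_at D k)"
proof -
  define K where "K = {k \<in> index D. wall_elt (wall_at D k) \<notin> G_gt l \<and> \<not> incoming (wall_at D k)}"
  have "finite {k \<in> index D. wall_elt (wall_at D k) \<notin> G_gt l}"
    using assms by (simp add: scattering_diagram_def)
  then have fin: "finite K" by (rule rev_finite_subset) (auto simp: K_def)
  have "\<exists>e>0. \<forall>y. norm (y - p_star (wall_normal (wall_at D k))) < e \<longrightarrow> y \<notin> wall_cone (wall_at D k)"
    if k: "k \<in> K" for k
  proof -
    have "closed (wall_cone (wall_at D k))"
      using k assms by (intro rational_polyhedral_coneD) (auto simp: K_def scattering_diagram_def is_wall_def)
    moreover have "p_star (wall_normal (wall_at D k)) \<notin> wall_cone (wall_at D k)"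
      using k by (simp add: K_def incoming_def)
    ultimately obtain e where "0 < e" "\<And>y. dist y (p_star (wall_normal (wall_at D k))) < e \<Longrightarrow> y \<in> - wall_cone (wall_at D k)"
      unfolding closed_def open_dist by (meson ComplI)
    then show ?thesis by (auto simp: dist_norm intro!: exI[of _ e])
  qed
  then obtain e where e: "\<And>k. k \<in> K \<Longrightarrow> 0 < e k"
    "\<And>k y. k \<in> K \<Longrightarrow> norm (y - p_star (wall_normal (wall_at D k))) < e k \<Longrightarrow> y \<notin> wall_cone (wall_at D k)"
    by metis
  show ?thesis
  proof
    \<comment> \<open>The inserted 1 covers the case of empty \<open>K\<close>.\<close>
    show "0 < Min (insert 1 (e ` K))" using fin e(1) by (subst Min_gr_iff) auto
    fix k y assume "k \<in> index D" "wall_elt (wall_at D k) \<notin> G_gt l" "\<not> incoming (wall_at D k)"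
      and y: "norm (y - p_star (wall_normal (wall_at D k))) < Min (insert 1 (e ` K))"
    then have k: "k \<in> K" by (simp add: K_def)
    have "Min (insert 1 (e ` K)) \<le> e k" using fin k by (intro Min_le) auto
    then show "y \<notin> wall_cone (wall_at D k)" using e(2)[OF k] y by simp
  qed
qed

lemma QCSD_incoming:
  assumes "QCSD D"
  obtains k where "k \<in> index D" "wall_at D k = initial_wall i"
    "\<And>k'. k' \<in> index D \<Longrightarrow> incoming (wall_at D k') \<Longrightarrow> wall_normal (wall_at D k') = basis i \<Longrightarrow> k' = k"
proof -
  let ?K = "{k \<in> index D. incoming (wall_at D k)}"
  have bij: "bij_betw (wall_at D) ?K (range initial_wall)" using assms by (simp add: QCSD_def)
  then obtain k where k: "k \<in> ?K" "wall_at D k = initial_wall i"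
    unfolding bij_betw_def by (metis (no_types, lifting) imageE rangeI)
  have "k' = k" if k': "k' \<in> index D" "incoming (wall_at D k')" "wall_normal (wall_at D k') = basis i" for k'
  proof -
    obtain m where m: "wall_at D k' = initial_wall m"
      using bij k' unfolding bij_betw_def by blast
    then have "basis m = (basis i :: int ^ 'r)" using k'(3) by (simp add: initial_wall_def)
    then have "m = i" by (metis basis_nth zero_neq_one)
    then show ?thesis using bij k k' m by (auto simp: bij_betw_def inj_on_def)
  qed
  with k show ?thesis using that by blast
qed

text \<open>Incoming walls are initial walls, whose normals have degree 1 and not 2.\<close>

lemma QCSD_not_incoming:
  assumes "QCSD D" "k \<in> index D" "wall_normal (wall_at D k) = basis i + basis j" "i \<noteq> j"
  shows "\<not> incoming (wall_at D k)"
proof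
  assume "incoming (wall_at D k)"
  then obtain m where "wall_at D k = initial_wall m"
    using assms(1,2) unfolding QCSD_def bij_betw_def by blast
  then have "basis m = (basis i + basis j :: int ^ 'r)" using assms(3) by (simp add: initial_wall_def)
  then have "deg (basis m :: int ^ 'r) = deg (basis i + basis j :: int ^ 'r)" by simp
  then show False by (simp add: deg_add deg_basis)
qed

lemma p_star_add: "p_star (m + n) = p_star m + p_star n"
  by (simp add: p_star_def vec_eq_iff form_add_right of_rat_add)

lemma form_self: "form m m = 0"
  using form_skew[of m m] by simp

text \<open>The loop passes near the directions \<open>p_star\<close> of \<open>basis i\<close>,
  \<open>basis i + basis j\<close>, \<open>basis j\<close> and then their negatives, in this order.
  In the one-sided cocycle every far crossing for \<open>basis i\<close> therefore meets exactly the
  incoming entry for \<open>basis j\<close>. \<open>K\<close> collects crossings rather than walls,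
  so a wall may count repeatedly.\<close>

lemma QCSD_outgoing_coefficient:
  fixes D :: "('l, 'r) walls"
  assumes QCSD: "QCSD D" and cnt: "countable (index D)" and ij: "i \<noteq> j"
    and pos: "0 < form (basis i) (basis j)"
  obtains K :: "(real \<times> 'l) set" where "finite K" "snd ` K \<subseteq> index D"
    "(\<Sum>x\<in>K. wall_elt (wall_at D (snd x)) (basis i + basis j)) =
      q_number (form (basis i) (basis j)) / (q_number (1 / of_nat (\<delta> i)) * q_number (1 / of_nat (\<delta> j)))"
proof -

  \<comment> \<open>Coordinates of the plane and choice of the loop\<close>
  define \<omega> :: real where "\<omega> = of_rat (form (basis i) (basis j))"
  have \<omega>: "0 < \<omega>" using pos by (simp add: \<omega>_def)
  \<comment> \<open>Normalised so that the coordinates at \<open>i\<close>, \<open>j\<close> are (1,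
    0) for \<open>U\<close> and (0, 1) for \<open>V\<close>. Then \<open>p_star (basis i)\<close>
    points along \<open>- V\<close> and \<open>p_star (basis j)\<close> along
    \<open>U\<close>.\<close>
  define U where "U = (1 / \<omega>) *\<^sub>R p_star (basis j)"
  define V where "V = - (1 / \<omega>) *\<^sub>R p_star (basis i)"
  have ji: "form (basis j) (basis i) = - form (basis i) (basis j)" by (rule form_skew)
  have UV [simp]: "U $ i = 1" "U $ j = 0" "V $ i = 0" "V $ j = 1"
    using \<omega> by (simp_all add: U_def V_def p_star_def form_self ji of_rat_minus \<omega>_def[symmetric])
  have p_star: "(x / \<omega>) *\<^sub>R p_star (basis i) = - (x *\<^sub>R V)" "(x / \<omega>) *\<^sub>R p_star (basis j) = x *\<^sub>R U"
    "(x / \<omega>) *\<^sub>R p_star (basis i + basis j) = x *\<^sub>R U - x *\<^sub>R V" for x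
    using \<omega> by (simp_all add: U_def V_def p_star_add algebra_simps)
  define u where "u = - (U + V)"
  define v where "v = U - V"
  have indep: "a = 0 \<and> b = 0" if "a *\<^sub>R u + b *\<^sub>R v = 0" for a b
    using arg_cong[OF that, of "\<lambda>x. x $ i"] arg_cong[OF that, of "\<lambda>x. x $ j"]
    by (simp add: u_def v_def)
  have sd: "scattering_diagram D" using QCSD by (simp add: QCSD_def)
  have wall: "is_wall (wall_at D k)" if "k \<in> index D" for k
    using sd that by (simp add: scattering_diagram_def)
  obtain \<eta> where \<eta>: "0 < \<eta>"
    "\<And>k y. k \<in> index D \<Longrightarrow> wall_elt (wall_at D k) \<notin> G_gt 2 \<Longrightarrow> \<not> incoming (wall_at D k) \<Longrightarrow>
      norm (y - p_star (wall_normal (wall_at D k))) < \<eta> \<Longrightarrow> y \<notin> wall_cone (wall_at D k)"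
    using scattering_diagram_far_cones[OF sd, of 2] by blast
  define R where "R = 1 + norm U + norm V"
  have R: "1 \<le> R" by (simp add: R_def)
  \<comment> \<open>The bound 1/10 serves the estimates on the unit circle. The other keeps the
    perturbation below \<open>\<eta>\<close> when a point is rescaled by a factor of at most
    \<open>2 * \<omega>\<close> towards \<open>p_star\<close> of a normal; \<open>R\<close> absorbs
    corrections along \<open>U\<close> and \<open>V\<close>.\<close>
  define \<epsilon> where "\<epsilon> = min (1 / 10) (\<eta> / (2 * \<omega> * R))"
  have "0 < \<epsilon>" using \<eta> \<omega> R by (simp add: \<epsilon>_def)
  obtain p \<rho> where p: "norm p < \<epsilon>" and \<rho>: "1 < \<rho>" "\<rho> < 2" and adm: "admissible D (ellipse p \<rho> u v)"
    using generic_ellipse[OF cnt wall indep \<open>0 < \<epsilon>\<close>] by blast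
  define \<gamma> where "\<gamma> = ellipse p \<rho> u v"
  have p10: "norm p \<le> 1 / 10" using p by (simp add: \<epsilon>_def)
  have pi: "\<bar>p $ m\<bar> \<le> norm p" for m by (rule component_le_norm_cart)
  have "norm p < \<eta> / (2 * \<omega> * R)" using p by (simp add: \<epsilon>_def)
  then have p\<eta>: "2 * \<omega> * (norm p * R) < \<eta>" using \<omega> R by (simp add: field_simps)
  define S where "S t = sin (2 * pi * t)" for t :: real
  define C where "C t = cos (2 * pi * t)" for t :: real
  have SC: "(S t)\<^sup>2 + (C t)\<^sup>2 = 1" for t by (simp add: S_def C_def)
  have \<gamma>: "\<gamma> t = p + \<rho> *\<^sub>R ((S t - C t) *\<^sub>R U - (S t + C t) *\<^sub>R V)" for t
    by (simp add: \<gamma>_def ellipse_def u_def v_def S_def C_def algebra_simps)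
  have \<gamma>i: "\<gamma> t $ i = p $ i + \<rho> * (S t - C t)" and \<gamma>j: "\<gamma> t $ j = p $ j - \<rho> * (S t + C t)" for t
    by (simp_all add: \<gamma> algebra_simps)
  have vel: "velocity \<gamma> t $ i = 2 * pi * \<rho> * (S t + C t)" "velocity \<gamma> t $ j = 2 * pi * \<rho> * (S t - C t)"
    if "t \<in> {0..1}" for t
    using that by (simp_all add: \<gamma>_def velocity_ellipse ellipse_velocity_def u_def v_def S_def C_def)
  have small: "\<bar>x\<bar> \<le> 1 / 10" if "\<bar>y\<bar> \<le> norm p" "\<rho> * x = y" for x y
  proof -
    have "\<bar>x\<bar> \<le> \<rho> * \<bar>x\<bar>" using \<rho> by (simp add: mult_le_cancel_right1)
    also have "\<dots> = \<bar>y\<bar>" using \<rho> that(2) by (auto simp: abs_mult)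
    finally show ?thesis using that(1) p10 by simp
  qed
  \<comment> \<open>Cones are invariant under positive scaling, and division by
    \<open>\<sigma>\<close> moves the point into the ball that the cone misses.\<close>
  have far: "\<gamma> t \<notin> wall_cone (wall_at D k)"
    if k: "k \<in> index D" "wall_elt (wall_at D k) \<notin> G_gt 2" "\<not> incoming (wall_at D k)"
      and t: "\<gamma> t = \<sigma> *\<^sub>R p_star (wall_normal (wall_at D k)) + r" "1 / (2 * \<omega>) \<le> \<sigma>" "norm r \<le> norm p * R"
    for t k \<sigma> r
  proof
    assume "\<gamma> t \<in> wall_cone (wall_at D k)"
    have \<sigma>: "0 < \<sigma>" using t(2) \<omega> by (smt (verit) zero_less_divide_iff)
    have "convex_cone (wall_cone (wall_at D k))"
      using wall[OF k(1)] by (auto simp: is_wall_def intro: rational_polyhedral_coneD)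
    then have in_cone: "(1 / \<sigma>) *\<^sub>R \<gamma> t \<in> wall_cone (wall_at D k)"
      using \<open>\<gamma> t \<in> _\<close> \<sigma> by (intro convex_cone_scaleR) auto
    have "(1 / \<sigma>) *\<^sub>R \<gamma> t - p_star (wall_normal (wall_at D k)) = (1 / \<sigma>) *\<^sub>R r"
      using \<sigma> by (simp add: t(1) algebra_simps)
    then have "norm ((1 / \<sigma>) *\<^sub>R \<gamma> t - p_star (wall_normal (wall_at D k))) = (1 / \<sigma>) * norm r"
      using \<sigma> by simp
    also have "\<dots> \<le> (2 * \<omega>) * (norm p * R)"
      using \<sigma> t(2,3) \<omega> by (intro mult_mono) (auto simp: field_simps)
    also have "\<dots> < \<eta>" using p\<eta> by simp
    finally show False using \<eta>(2)[OF k] in_cone by blast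
  qed
  have R_bound: "norm (p + a *\<^sub>R U + b *\<^sub>R V) \<le> norm p * R" if "\<bar>a\<bar> \<le> norm p" "\<bar>b\<bar> \<le> norm p" for a b
  proof -
    have "norm (p + a *\<^sub>R U + b *\<^sub>R V) \<le> norm p + \<bar>a\<bar> * norm U + \<bar>b\<bar> * norm V"
      by (metis (no_types) norm_triangle_mono norm_triangle_ineq norm_scaleR order_refl)
    also have "\<dots> \<le> norm p + norm p * norm U + norm p * norm V"
      using that by (intro add_mono mult_right_mono) auto
    finally show ?thesis by (simp add: R_def algebra_simps)
  qed
  obtain ki where ki: "ki \<in> index D" "wall_at D ki = initial_wall i"
    "\<And>k'. k' \<in> index D \<Longrightarrow> incoming (wall_at D k') \<Longrightarrow> wall_normal (wall_at D k') = basis i \<Longrightarrow> k' = ki"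
    using QCSD_incoming[OF QCSD, of i] by blast
  obtain kj where kj: "kj \<in> index D" "wall_at D kj = initial_wall j"
    "\<And>k'. k' \<in> index D \<Longrightarrow> incoming (wall_at D k') \<Longrightarrow> wall_normal (wall_at D k') = basis j \<Longrightarrow> k' = kj"
    using QCSD_incoming[OF QCSD, of j] by blast
  define A where "A = 1 / q_number (1 / of_nat (\<delta> i))"
  define B where "B = 1 / q_number (1 / of_nat (\<delta> j))"
  have init: "\<Psi> (1 / of_nat (\<delta> m)) 0 (basis m) (basis m) = 1 / q_number (1 / of_nat (\<delta> m))" for m
  proof -
    have "basis m \<noteq> (0 :: int ^ 'r)" by (metis basis_nth zero_index zero_neq_one)
    then show ?thesis by (simp add: \<Psi>_self q_power_def)
  qed
  have init_nontrivial: "\<Psi> (1 / of_nat (\<delta> m)) 0 (basis m) \<notin> G_gt 2" for m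
  proof -
    have "\<Psi> (1 / of_nat (\<delta> m)) 0 (basis m) (basis m) \<noteq> 0"
      by (simp add: init q_number_inverse_\<delta>_nonzero)
    moreover have "deg (basis m :: int ^ 'r) \<le> int 2" by (simp add: deg_basis)
    ultimately show ?thesis unfolding G_gt_def by blast
  qed

  \<comment> \<open>Crossings that contribute at \<open>basis i\<close> or
    \<open>basis j\<close>\<close>
  define X where "X = crossings 2 D \<gamma>"
  define g where "g = crossing_elt D \<gamma>"
  have X: "t \<in> {0..1}" "k \<in> index D" "\<gamma> t \<in> wall_cone (wall_at D k)" "wall_elt (wall_at D k) \<notin> G_gt 2"
    "pairing (wall_normal (wall_at D k)) (\<gamma> t) = 0" if "(t, k) \<in> X" for t k
    using that wall[of k] by (auto simp: X_def crossings_def is_wall_def orth_def)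
  have g: "g (t, k) n = (if pairing (wall_normal (wall_at D k)) (velocity \<gamma> t) < 0
     then wall_elt (wall_at D k) n else - wall_elt (wall_at D k) n)" for t k n
    by (simp add: g_def crossing_elt_eq)

  have a_cross: "wall_normal (wall_at D k) = basis i" "\<rho> * (S t - C t) = - p $ i"
      "\<bar>S t - C t\<bar> \<le> 1 / 10" "1 \<le> \<bar>S t + C t\<bar>"
    if x: "(t, k) \<in> X" "g (t, k) (basis i) \<noteq> 0" for t k
  proof -
    show n: "wall_normal (wall_at D k) = basis i"
      using x wall[OF X(2)] by (intro wall_elt_basis) (auto simp: g split: if_splits)
    show e: "\<rho> * (S t - C t) = - p $ i"
      using X(5)[OF x(1)] by (simp add: n pairing_basis \<gamma>i)
    show "\<bar>S t - C t\<bar> \<le> 1 / 10" using small[OF _ e] pi[of i] by simp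
    then show "1 \<le> \<bar>S t + C t\<bar>" by (rule unit_circle_bounds(1)[OF SC])
  qed
  have b_cross: "wall_normal (wall_at D k) = basis j" "\<rho> * (S t + C t) = p $ j"
      "\<bar>S t + C t\<bar> \<le> 1 / 10" "1 \<le> \<bar>S t - C t\<bar>"
    if x: "(t, k) \<in> X" "g (t, k) (basis j) \<noteq> 0" for t k
  proof -
    show n: "wall_normal (wall_at D k) = basis j"
      using x wall[OF X(2)] by (intro wall_elt_basis) (auto simp: g split: if_splits)
    show e: "\<rho> * (S t + C t) = p $ j"
      using X(5)[OF x(1)] by (simp add: n pairing_basis \<gamma>j)
    show "\<bar>S t + C t\<bar> \<le> 1 / 10" using small[OF _ e] pi[of j] by simp
    then show "1 \<le> \<bar>S t - C t\<bar>" by (rule unit_circle_bounds(2)[OF SC])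
  qed
  \<comment> \<open>When one of \<open>S t + C t\<close>, \<open>S t - C t\<close> dominates the
    other, the signs of sine and cosine are known, which fixes the quarter of the loop.\<close>
  have time: "S t + C t > 0 \<Longrightarrow> \<bar>S t - C t\<bar> \<le> 1 / 10 \<Longrightarrow> 1 \<le> \<bar>S t + C t\<bar> \<Longrightarrow> t < 1 / 4"
    "S t - C t > 0 \<Longrightarrow> \<bar>S t + C t\<bar> \<le> 1 / 10 \<Longrightarrow> 1 \<le> \<bar>S t - C t\<bar> \<Longrightarrow> 1 / 4 < t \<and> t < 1 / 2"
    "S t + C t < 0 \<Longrightarrow> \<bar>S t - C t\<bar> \<le> 1 / 10 \<Longrightarrow> 1 \<le> \<bar>S t + C t\<bar> \<Longrightarrow> 1 / 2 < t \<and> t < 3 / 4"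
    "S t - C t < 0 \<Longrightarrow> \<bar>S t + C t\<bar> \<le> 1 / 10 \<Longrightarrow> 1 \<le> \<bar>S t - C t\<bar> \<Longrightarrow> 3 / 4 < t"
    if "t \<in> {0..1}" for t
    unfolding S_def C_def by (rule quadrant_time; use that in \<open>auto simp: abs_if split: if_splits\<close>)+

  \<comment> \<open>The unique near crossing for \<open>basis i\<close>\<close>
  have "\<exists>t\<ge>0. t \<le> 1 / 4 \<and> S t - C t = - p $ i / \<rho>"
  proof (rule IVT')
    have "\<bar>- p $ i / \<rho>\<bar> \<le> 1 / 10" using small[of "- p $ i" "- p $ i / \<rho>"] pi[of i] \<rho> by simp
    then have "- 1 \<le> - p $ i / \<rho>" "- p $ i / \<rho> \<le> 1" by linarith+
    then show "S 0 - C 0 \<le> - p $ i / \<rho>" "- p $ i / \<rho> \<le> S (1 / 4) - C (1 / 4)"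
      by (auto simp: S_def C_def)
    show "continuous_on {0..1 / 4} (\<lambda>t. S t - C t)"
      unfolding S_def C_def by (intro continuous_intros)
  qed simp
  then obtain t1 where t1: "0 \<le> t1" "t1 \<le> 1 / 4" "S t1 - C t1 = - p $ i / \<rho>" by blast
  have t1': "\<rho> * (S t1 - C t1) = - p $ i" using t1(3) \<rho> by simp
  have "0 \<le> 2 * pi * t1" "2 * pi * t1 \<le> 2 * pi * (1 / 4)" using t1 by (auto intro!: mult_left_mono)
  then have "0 \<le> S t1" "0 \<le> C t1"
    unfolding S_def C_def using pi_gt_zero by (intro sin_ge_zero cos_ge_zero; linarith)+
  moreover have s1: "\<bar>S t1 - C t1\<bar> \<le> 1 / 10" using small[OF _ t1'] pi[of i] by simp
  then have "1 \<le> \<bar>S t1 + C t1\<bar>" by (rule unit_circle_bounds(1)[OF SC])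
  ultimately have p1: "1 \<le> S t1 + C t1" by simp
  \<comment> \<open>The initial wall is a full hyperplane, so the vanishing of coordinate
    \<open>i\<close> suffices for a crossing.\<close>
  have x1X: "(t1, ki) \<in> X"
    using ki t1 t1' init_nontrivial
    by (simp add: X_def crossings_def initial_wall_def orth_def pairing_basis \<gamma>i)
  \<comment> \<open>Coordinate \<open>i\<close> increases here, so the wall element enters
    inverted.\<close>
  have gx1: "g (t1, ki) (basis i) = - A"
    using t1 p1 \<rho> by (simp add: g ki(2) initial_wall_def pairing_basis vel init A_def mult_less_0_iff)
  have x1: "(t, k) = (t1, ki)" if x: "(t, k) \<in> X" "g (t, k) (basis i) \<noteq> 0" "0 < S t + C t" for t k
  proof -
    note a = a_cross[OF x(1,2)]
    have "incoming (wall_at D k)"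
    proof (rule ccontr)
      assume "\<not> incoming (wall_at D k)"
      \<comment> \<open>The crossing equation turns the \<open>U\<close> part into a small
        remainder, leaving a multiple of \<open>p_star (basis i)\<close> that is bounded
        below.\<close>
      have "\<gamma> t = (\<rho> * (S t + C t) / \<omega>) *\<^sub>R p_star (wall_normal (wall_at D k)) + (p + (- p $ i) *\<^sub>R U + 0 *\<^sub>R V)"
        by (simp add: \<gamma> a(1) p_star algebra_simps flip: a(2))
      moreover have "1 / (2 * \<omega>) \<le> \<rho> * (S t + C t) / \<omega>"
      proof -
        have "1 * 1 \<le> \<rho> * (S t + C t)" using \<rho> a(4) x(3) by (intro mult_mono) auto
        then show ?thesis using \<omega> by (simp add: field_simps)
      qed
      moreover have "norm (p + (- p $ i) *\<^sub>R U + 0 *\<^sub>R V) \<le> norm p * R"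
        using pi[of i] by (intro R_bound) auto
      ultimately show False
        using far[OF X(2)[OF x(1)] X(4)[OF x(1)] \<open>\<not> incoming _\<close>] X(3)[OF x(1)] by blast
    qed
    then have "k = ki" using ki(3) X(2)[OF x(1)] a(1) by blast
    moreover have "t = t1"
    proof -
      \<comment> \<open>The crossing equation fixes \<open>S t - C t\<close>. The squares of sum and
        difference add up to 2, so \<open>S t + C t\<close> is fixed up to sign, and it is
        positive.\<close>
      have d: "S t - C t = S t1 - C t1" using a(2) t1' \<rho> by (metis mult_left_cancel not_one_less_zero order_less_irrefl)
      have "(S t + C t)\<^sup>2 + (S t - C t)\<^sup>2 = (S t1 + C t1)\<^sup>2 + (S t1 - C t1)\<^sup>2"
        using SC[of t] SC[of t1] by (simp add: power2_eq_square algebra_simps)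
      then have "(S t + C t)\<^sup>2 = (S t1 + C t1)\<^sup>2" using d by simp
      then have "S t + C t = S t1 + C t1" using x(3) p1 by (simp add: power2_eq_iff_nonneg)
      then have C: "C t = C t1" using d by simp
      have "t < 1 / 4" using time(1)[OF X(1)[OF x(1)] x(3) a(3,4)] .
      then have "0 \<le> t" "t \<le> 1 / 2" "0 \<le> t1" "t1 \<le> 1 / 2" using X(1)[OF x(1)] t1 by auto
      then show ?thesis using C unfolding C_def by (rule cos_time_inject)
    qed
    ultimately show ?thesis by simp
  qed

  \<comment> \<open>The unique near crossing for \<open>basis j\<close>\<close>
  have "\<exists>t\<ge>1 / 4. t \<le> 1 / 2 \<and> - (S t + C t) = - p $ j / \<rho>"
  proof (rule IVT')
    have "\<bar>- p $ j / \<rho>\<bar> \<le> 1 / 10" using small[of "- p $ j" "- p $ j / \<rho>"] pi[of j] \<rho> by simp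
    then have "- 1 \<le> - p $ j / \<rho>" "- p $ j / \<rho> \<le> 1" by linarith+
    then show "- (S (1 / 4) + C (1 / 4)) \<le> - p $ j / \<rho>" "- p $ j / \<rho> \<le> - (S (1 / 2) + C (1 / 2))"
      by (auto simp: S_def C_def)
    show "continuous_on {1 / 4..1 / 2} (\<lambda>t. - (S t + C t))"
      unfolding S_def C_def by (intro continuous_intros)
  qed simp
  then obtain t3 where t3: "1 / 4 \<le> t3" "t3 \<le> 1 / 2" "S t3 + C t3 = p $ j / \<rho>" by auto
  have t3': "\<rho> * (S t3 + C t3) = p $ j" using t3(3) \<rho> by simp
  have b3: "2 * pi * (1 / 4) \<le> 2 * pi * t3" "2 * pi * t3 \<le> 2 * pi * (1 / 2)"
    using t3 by (auto intro!: mult_left_mono)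
  have "0 \<le> S t3" unfolding S_def using b3 pi_gt_zero by (intro sin_ge_zero; linarith)
  moreover have "C t3 \<le> 0"
    unfolding C_def using cos_monotone_0_pi_le[of "pi / 2" "2 * pi * t3"] b3 by simp
  moreover have "\<bar>S t3 + C t3\<bar> \<le> 1 / 10" using small[OF _ t3'] pi[of j] by simp
  then have "1 \<le> \<bar>S t3 - C t3\<bar>" by (rule unit_circle_bounds(2)[OF SC])
  ultimately have p3: "1 \<le> S t3 - C t3" by simp
  have x3X: "(t3, kj) \<in> X"
    using kj t3 t3' init_nontrivial
    by (simp add: X_def crossings_def initial_wall_def orth_def pairing_basis \<gamma>j)
  have gx3: "g (t3, kj) (basis j) = - B"
    using t3 p3 \<rho> by (simp add: g kj(2) initial_wall_def pairing_basis vel init B_def mult_less_0_iff)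
  have x3: "(t, k) = (t3, kj)" if x: "(t, k) \<in> X" "g (t, k) (basis j) \<noteq> 0" "0 < S t - C t" for t k
  proof -
    note b = b_cross[OF x(1,2)]
    have "incoming (wall_at D k)"
    proof (rule ccontr)
      assume "\<not> incoming (wall_at D k)"
      have "\<gamma> t = (\<rho> * (S t - C t) / \<omega>) *\<^sub>R p_star (wall_normal (wall_at D k)) + (p + 0 *\<^sub>R U + (- p $ j) *\<^sub>R V)"
        by (simp add: \<gamma> b(1) p_star algebra_simps flip: b(2))
      moreover have "1 / (2 * \<omega>) \<le> \<rho> * (S t - C t) / \<omega>"
      proof -
        have "1 * 1 \<le> \<rho> * (S t - C t)" using \<rho> b(4) x(3) by (intro mult_mono) auto
        then show ?thesis using \<omega> by (simp add: field_simps)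
      qed
      moreover have "norm (p + 0 *\<^sub>R U + (- p $ j) *\<^sub>R V) \<le> norm p * R"
        using pi[of j] by (intro R_bound) auto
      ultimately show False
        using far[OF X(2)[OF x(1)] X(4)[OF x(1)] \<open>\<not> incoming _\<close>] X(3)[OF x(1)] by blast
    qed
    then have "k = kj" using kj(3) X(2)[OF x(1)] b(1) by blast
    moreover have "t = t3"
    proof -
      have d: "S t + C t = S t3 + C t3" using b(2) t3' \<rho> by (metis mult_left_cancel not_one_less_zero order_less_irrefl)
      have "(S t + C t)\<^sup>2 + (S t - C t)\<^sup>2 = (S t3 + C t3)\<^sup>2 + (S t3 - C t3)\<^sup>2"
        using SC[of t] SC[of t3] by (simp add: power2_eq_square algebra_simps)
      then have "(S t - C t)\<^sup>2 = (S t3 - C t3)\<^sup>2" using d by simp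
      then have "S t - C t = S t3 - C t3" using x(3) p3 by (simp add: power2_eq_iff_nonneg)
      then have C: "C t = C t3" using d by simp
      have "t < 1 / 2" using time(2)[OF X(1)[OF x(1)] x(3) b(3,4)] by simp
      then have "0 \<le> t" "t \<le> 1 / 2" "0 \<le> t3" "t3 \<le> 1 / 2" using X(1)[OF x(1)] t3 by auto
      then show ?thesis using C unfolding C_def by (rule cos_time_inject)
    qed
    ultimately show ?thesis by simp
  qed

  \<comment> \<open>Crossings with normal \<open>basis i + basis j\<close>\<close>
  have c_cross: "g (t, k) (basis i + basis j) = wall_elt (wall_at D k) (basis i + basis j)"
    if x: "(t, k) \<in> X" for t k
  proof (cases "wall_elt (wall_at D k) (basis i + basis j) = 0")
    case False
    have n: "wall_normal (wall_at D k) = basis i + basis j"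
      using wall[OF X(2)[OF x]] False ij by (rule wall_elt_basis_add)
    have not_inc: "\<not> incoming (wall_at D k)" using QCSD_not_incoming[OF QCSD X(2)[OF x] n ij] .
    have e: "\<rho> * C t = (p $ i + p $ j) / 2"
      using X(5)[OF x] by (simp add: n pairing_add_left pairing_basis \<gamma>i \<gamma>j algebra_simps)
    have pij: "\<bar>(p $ i + p $ j) / 2\<bar> \<le> norm p" using pi[of i] pi[of j] by simp
    have "1 / 2 \<le> \<bar>S t\<bar>" by (rule unit_circle_bounds(3)[OF SC small[OF pij e]])
    \<comment> \<open>For \<open>1 / 2 \<le> S t\<close> the point is near the ray of
      \<open>p_star\<close> of the normal, which non-incoming walls miss. So the crossing is on the
      opposite side, where its sign is +1.\<close>
    moreover have "\<not> 1 / 2 \<le> S t"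
    proof
      assume S: "1 / 2 \<le> S t"
      have "\<gamma> t = (\<rho> * S t / \<omega>) *\<^sub>R p_star (wall_normal (wall_at D k)) +
          (p + (- ((p $ i + p $ j) / 2)) *\<^sub>R U + (- ((p $ i + p $ j) / 2)) *\<^sub>R V)"
        by (simp add: \<gamma> n p_star algebra_simps flip: e)
      moreover have "1 / (2 * \<omega>) \<le> \<rho> * S t / \<omega>"
      proof -
        have "1 * (1 / 2) \<le> \<rho> * S t" using \<rho> S by (intro mult_mono) auto
        then show ?thesis using \<omega> by (simp add: field_simps)
      qed
      moreover have "norm (p + (- ((p $ i + p $ j) / 2)) *\<^sub>R U + (- ((p $ i + p $ j) / 2)) *\<^sub>R V) \<le> norm p * R"
        using pij by (intro R_bound) auto
      ultimately show False
        using far[OF X(2)[OF x] X(4)[OF x] not_inc] X(3)[OF x] by blast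
    qed
    ultimately have "S t < 0" by linarith
    moreover have "pairing (wall_normal (wall_at D k)) (velocity \<gamma> t) = 4 * pi * \<rho> * S t"
      using X(1)[OF x] by (simp add: n pairing_add_left pairing_basis vel algebra_simps)
    ultimately have "pairing (wall_normal (wall_at D k)) (velocity \<gamma> t) < 0"
      using \<rho> by (simp add: mult_less_0_iff)
    then show ?thesis by (simp add: g)
  qed (simp add: g)

  \<comment> \<open>Consistency along the loop\<close>
  have "\<gamma> 0 = \<gamma> 1" by (simp add: \<gamma>_def ellipse_def)
  then have "has_path_product D \<gamma> G_one"
    using QCSD adm by (simp add: QCSD_def consistent_def \<gamma>_def)
  then obtain cs where cs: "distinct cs" "set cs = X" "sorted (map fst cs)"
    "G_eq_upto 2 G_one (fold (\<lambda>c h. G_mult (g c) h) cs G_one)"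
    unfolding has_path_product_def X_def g_def by blast
  have finX: "finite X" using cs(2) by (metis List.finite_set)
  define P where "P = fold (\<lambda>c h. G_mult (g c) h) cs G_one"
  have "G_pow G_one (- 1) = (G_one :: 'r lie)" by (simp add: G_pow_def G_one_def)
  then have "G_mult G_one P \<in> G_gt 2" using cs(4) by (simp add: G_eq_upto_def P_def)
  then have "G_mult G_one P n = 0" if "deg n \<le> 2" for n using that by (simp add: G_gt_def)
  from this[of "basis i"] this[of "basis j"] this[of "basis i + basis j"]
  have P0: "P (basis i) = 0" "P (basis j) = 0" "P (basis i + basis j) = 0"
    by (simp_all add: deg_basis deg_add G_mult_basis G_mult_basis_add[OF ij] G_one_def)
  \<comment> \<open>At a common time \<open>S t + C t\<close> would be both at least 1 and at most
    1/10 in absolute value.\<close>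
  have "\<forall>x\<in>set cs. \<forall>y\<in>set cs. fst x = fst y \<longrightarrow> g x (basis i) * g y (basis j) = 0"
  proof (intro ballI impI, rule ccontr)
    fix x y assume x: "x \<in> set cs" and y: "y \<in> set cs" and eq: "fst x = fst y"
      and nz: "g x (basis i) * g y (basis j) \<noteq> 0"
    have "(fst x, snd x) \<in> X" "g (fst x, snd x) (basis i) \<noteq> 0" using x nz cs(2) by auto
    moreover have "(fst x, snd y) \<in> X" "g (fst x, snd y) (basis j) \<noteq> 0"
      using y nz cs(2) unfolding eq by auto
    ultimately show False using a_cross(4) b_cross(3) by fastforce
  qed
  note prod = ordered_product_coeffs[OF ij cs(1,3) this, folded P_def, unfolded cs(2) P0]
  define w where "w = q_number (form (basis i) (basis j))"
  define I where "I x = (\<Sum>y | y \<in> X \<and> fst y < fst x. g y (basis j))" for x :: "real \<times> 'l"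
  have total: "(\<Sum>x\<in>X. g x (basis i)) = 0" using prod(1) by simp
  have main: "0 = (\<Sum>x\<in>X. g x (basis i + basis j)) + w * (\<Sum>x\<in>X. g x (basis i) * I x)"
    using prod(3) by (simp add: w_def I_def)
  \<comment> \<open>Entries at \<open>basis j\<close> occur only after time 1/4, hence after
    \<open>t1\<close>.\<close>
  have I1: "I (t1, ki) = 0"
    unfolding I_def
  proof (rule sum.neutral, rule ballI, rule ccontr)
    fix y assume y: "y \<in> {y. y \<in> X \<and> fst y < fst (t1, ki)}" "g y (basis j) \<noteq> 0"
    moreover obtain t k where "y = (t, k)" by (rule prod.exhaust)
    ultimately have tk: "y = (t, k)" "(t, k) \<in> X" "t < t1" by auto
    note b = b_cross[OF tk(2) y(2)[unfolded tk(1)]]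
    have "1 / 4 < t"
      using time(2)[OF X(1)[OF tk(2)] _ b(3,4)] time(4)[OF X(1)[OF tk(2)] _ b(3,4)] b(4) by linarith
    then show False using tk(3) t1(2) by simp
  qed
  \<comment> \<open>The remaining entries at \<open>basis i\<close> lie between times 1/2 and 3/4.
    The entry \<open>- B\<close> at \<open>t3\<close> precedes them; all other entries at
    \<open>basis j\<close> come after 3/4.\<close>
  have I4: "g x (basis i) * I x = - B * g x (basis i)" if x: "x \<in> X - {(t1, ki)}" for x
  proof (cases "g x (basis i) = 0")
    case False
    obtain t k where tk: "x = (t, k)" "(t, k) \<in> X" using x by (metis DiffD1 prod.collapse)
    note a = a_cross[OF tk(2) False[unfolded tk(1)]]
    have "\<not> 0 < S t + C t"
    proof
      assume "0 < S t + C t"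
      from x1[OF tk(2) False[unfolded tk(1)] this] show False using x unfolding tk(1) by blast
    qed
    then have "S t + C t < 0" using a(4) by linarith
    then have t: "1 / 2 < t" "t < 3 / 4" using time(3)[OF X(1)[OF tk(2)] _ a(3,4)] by auto
    have "I x = (\<Sum>y\<in>{(t3, kj)}. g y (basis j))"
      unfolding I_def
    proof (rule sum.mono_neutral_right)
      show "finite {y \<in> X. fst y < fst x}" using finX by simp
      show "{(t3, kj)} \<subseteq> {y \<in> X. fst y < fst x}" using x3X t3 t tk by auto
      show "\<forall>y\<in>{y \<in> X. fst y < fst x} - {(t3, kj)}. g y (basis j) = 0"
      proof (rule ballI, rule ccontr)
        fix y assume y: "y \<in> {y \<in> X. fst y < fst x} - {(t3, kj)}" "g y (basis j) \<noteq> 0"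
        moreover obtain t' k' where "y = (t', k')" by (rule prod.exhaust)
        ultimately have y': "y = (t', k')" "(t', k') \<in> X" "t' < t" using tk(1) by auto
        note b = b_cross[OF y'(2) y(2)[unfolded y'(1)]]
        have "\<not> 0 < S t' - C t'"
        proof
          assume "0 < S t' - C t'"
          from x3[OF y'(2) y(2)[unfolded y'(1)] this] show False using y(1) unfolding y'(1) by blast
        qed
        then have "S t' - C t' < 0" using b(4) by linarith
        then show False using time(4)[OF X(1)[OF y'(2)] _ b(3,4)] y'(3) t by simp
      qed
    qed
    then show ?thesis by (simp add: gx3)
  qed simp
  have "(\<Sum>x\<in>X. g x (basis i) * I x) = (\<Sum>x\<in>X - {(t1, ki)}. g x (basis i) * I x)"
    using sum.remove[OF finX x1X, of "\<lambda>x. g x (basis i) * I x"] by (simp add: I1)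
  also have "\<dots> = - B * (\<Sum>x\<in>X - {(t1, ki)}. g x (basis i))"
    using I4 by (simp add: sum_distrib_left)
  \<comment> \<open>All entries at \<open>basis i\<close> sum to 0, and the removed one is
    \<open>- A\<close>.\<close>
  also have "(\<Sum>x\<in>X - {(t1, ki)}. g x (basis i)) = A"
    using sum.remove[OF finX x1X, of "\<lambda>x. g x (basis i)"] total gx1 by simp
  finally have "(\<Sum>x\<in>X. g x (basis i + basis j)) = w * A * B" using main by simp
  moreover have "(\<Sum>x\<in>X. g x (basis i + basis j)) = (\<Sum>x\<in>X. wall_elt (wall_at D (snd x)) (basis i + basis j))"
    using c_cross by (intro sum.cong) auto
  ultimately have "(\<Sum>x\<in>X. wall_elt (wall_at D (snd x)) (basis i + basis j)) =
      q_number (form (basis i) (basis j)) / (q_number (1 / of_nat (\<delta> i)) * q_number (1 / of_nat (\<delta> j)))"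
    by (simp add: w_def A_def B_def)
  moreover have "snd ` X \<subseteq> index D" using X(2) by auto
  ultimately show ?thesis using that finX by blast
qed

section \<open>Positivity contradicts the total coefficient\<close>

lemma not_positive_realization:
  fixes D :: "('l, 'r) walls"
  assumes ij: "i \<noteq> j" and pos: "0 < form (basis i) (basis j)"
    and nd: "\<not> \<delta> i dvd \<delta> j" "\<not> \<delta> j dvd \<delta> i"
  shows "\<not> positive_realization D"
proof
  assume pr: "positive_realization D"
  then have "QCSD D" by (simp add: positive_realization_def)
  then obtain K :: "(real \<times> 'l) set" where K: "finite K" "snd ` K \<subseteq> index D"
    "(\<Sum>x\<in>K. wall_elt (wall_at D (snd x)) (basis i + basis j)) =
      q_number (form (basis i) (basis j)) / (q_number (1 / of_nat (\<delta> i)) * q_number (1 / of_nat (\<delta> j)))"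
    using QCSD_outgoing_coefficient[OF _ positive_realization_countable[OF pr] ij pos] by blast
  \<comment> \<open>In powers of \<open>q_root\<close>, the quantum numbers at
    \<open>1 / \<delta> i\<close>, \<open>1 / \<delta> j\<close>, \<open>1 / L\<close> have
    exponents \<open>d * a\<close>, \<open>d * b\<close>, \<open>d\<close>. Non-divisibility makes
    \<open>a\<close> and \<open>b\<close> exceed 1, so \<open>d\<close> is the smallest.\<close>
  define L where "L = lcm (\<delta> i) (\<delta> j)"
  have L0: "0 < L" using \<delta>_pos by (simp add: L_def lcm_pos_nat)
  have "L dvd \<delta>\<^sub>0" using \<delta>_dvd_\<delta>\<^sub>0 by (simp add: L_def)
  then obtain d where d: "\<delta>\<^sub>0 = L * d" by blast
  obtain a where a: "L = \<delta> i * a" unfolding L_def by (meson dvd_lcm1 dvdE)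
  obtain b where b: "L = \<delta> j * b" unfolding L_def by (meson dvd_lcm2 dvdE)
  have "a \<noteq> 1" "b \<noteq> 1" using a b nd by (metis L_def dvd_lcm2 mult.right_neutral, metis L_def dvd_lcm1 mult.right_neutral)
  moreover have "a \<noteq> 0" "b \<noteq> 0" using a b L0 by (metis mult_0_right less_irrefl)+
  ultimately have ab: "1 < a" "1 < b" by linarith+
  have d0: "0 < d" using d \<delta>\<^sub>0_pos by (cases d) auto
  obtain W where W: "of_nat \<delta>\<^sub>0 * form (basis i) (basis j) = of_int W"
    using \<delta>\<^sub>0_form_integral[of i j] by (rule Ints_cases)
  have "0 < (of_int W :: rat)" using pos \<delta>\<^sub>0_pos unfolding W[symmetric] by simp
  then have W0: "0 < W" by simp
  define t where "t = q_root"
  define z where "z = t powi \<delta>\<^sub>0 - t powi (- \<delta>\<^sub>0)"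
  have z: "z \<noteq> 0" using q_denominator_nonzero by (simp add: z_def t_def)
  have qi: "q_number (1 / of_nat (\<delta> i)) = (t powi (d * a) - t powi (- (d * a))) / z"
    unfolding t_def z_def by (rule q_number_integral) (use \<delta>_pos[of i] in \<open>simp add: d a\<close>)
  have qj: "q_number (1 / of_nat (\<delta> j)) = (t powi (d * b) - t powi (- (d * b))) / z"
    unfolding t_def z_def by (rule q_number_integral) (use \<delta>_pos[of j] in \<open>simp add: d b\<close>)
  have qL: "q_number (1 / of_nat L) = (t powi d - t powi (- d)) / z"
    unfolding t_def z_def by (rule q_number_integral) (use L0 in \<open>simp add: d\<close>)
  have qW: "q_number (form (basis i) (basis j)) = (t powi W - t powi (- W)) / z"
    unfolding t_def z_def by (rule q_number_integral) (rule W)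
  have qL0: "q_number (1 / of_nat L) \<noteq> 0"
    by (rule q_number_nonzero) (use L0 d0 in \<open>simp add: d\<close>)
  have "\<exists>c e. wall_elt (wall_at D (snd x)) (basis i + basis j) * q_number (1 / of_nat L) =
      Fract [:of_nat c:] 1 * q_root powi e" if x: "x \<in> K" for x
  proof -
    have "snd x \<in> index D" using K(2) x by blast
    then obtain n \<beta> c where w: "wall_elt (wall_at D (snd x)) = G_pow (\<Psi> (1 / \<delta>_of n) \<beta> n) (of_nat c)"
      using pr unfolding positive_realization_def by blast
    show ?thesis
    proof (cases "n = basis i + basis j")
      case True
      have "n \<noteq> 0" using True ij by (auto simp: vec_eq_iff basis_nth intro!: exI[of _ i])
      then have "wall_elt (wall_at D (snd x)) (basis i + basis j) * q_number (1 / of_nat L) =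
          Fract [:of_nat c:] 1 * q_power \<beta>"
        using qL0 \<Psi>_self[of n] by (simp add: w G_pow_def True \<delta>_of_basis_add[OF ij] L_def)
      then show ?thesis unfolding q_power_def by blast
    next
      case False
      then have "wall_elt (wall_at D (snd x)) (basis i + basis j) = 0"
        using \<Psi>_basis_add[OF ij] by (auto simp: w G_pow_def)
      \<comment> \<open>A crossing without contribution is recorded with coefficient 0.\<close>
      then show ?thesis by (intro exI[of _ 0]) (simp add: Zero_fract_def)
    qed
  qed
  then obtain c :: "real \<times> 'l \<Rightarrow> nat" and e where ce: "\<And>x. x \<in> K \<Longrightarrow>
      wall_elt (wall_at D (snd x)) (basis i + basis j) * q_number (1 / of_nat L) = Fract [:of_nat (c x):] 1 * q_root powi e x"
    by metis
  have "(\<Sum>x\<in>K. Fract [:of_nat (c x):] 1 * q_root powi e x) =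
      (\<Sum>x\<in>K. wall_elt (wall_at D (snd x)) (basis i + basis j)) * q_number (1 / of_nat L)"
    by (simp add: ce sum_distrib_right)
  also have "\<dots> = q_number (form (basis i) (basis j)) * q_number (1 / of_nat L) /
      (q_number (1 / of_nat (\<delta> i)) * q_number (1 / of_nat (\<delta> j)))"
    by (simp add: K(3))
  finally have "(\<Sum>x\<in>K. Fract [:of_nat (c x):] 1 * q_root powi e x) *
      (q_number (1 / of_nat (\<delta> i)) * q_number (1 / of_nat (\<delta> j))) =
      q_number (form (basis i) (basis j)) * q_number (1 / of_nat L)"
    by (simp add: q_number_inverse_\<delta>_nonzero)
  \<comment> \<open>Each side carries two quantum numbers, so the common denominators
    \<open>z\<close> cancel.\<close>
  then have "(\<Sum>x\<in>K. Fract [:of_nat (c x):] 1 * q_root powi e x) *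
      (t powi (d * a) - t powi (- (d * a))) * (t powi (d * b) - t powi (- (d * b))) =
      (t powi W - t powi (- W)) * (t powi d - t powi (- d))"
    unfolding qi qj qL qW using z by (simp add: field_simps)
  then show False
    unfolding t_def by (rule no_nonneg_laurent_quotient[OF K(1)]) (use d0 W0 ab in auto)
qed

end

theorem corollary5p12:
  fixes form :: "int ^ 'r::finite \<Rightarrow> int ^ 'r \<Rightarrow> rat"
    and \<delta> :: "'r \<Rightarrow> nat"
    and D :: "('l, 'r) walls"
    and i j :: 'r
  assumes "seed_data form \<delta>"
    and "seed_data.QCSD form \<delta> D"
    and "i \<noteq> j"
    and "seed_data.exchange_matrix form \<delta> i j \<noteq> 0"
    and "\<not> \<delta> i dvd \<delta> j"
    and "\<not> \<delta> j dvd \<delta> i"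
  shows "\<not> seed_data.positive form \<delta> TYPE('m) D"
proof -
  interpret seed_data form \<delta> by (rule assms(1))
  have "form (basis i) (basis j) \<noteq> 0" using assms(4) by (simp add: exchange_matrix_eq)
  \<comment> \<open>Skew-symmetry makes the value positive after exchanging \<open>i\<close> and
    \<open>j\<close> if necessary, and the pair of non-divisibility conditions is symmetric.\<close>
  then consider "0 < form (basis i) (basis j)" | "0 < form (basis j) (basis i)"
    using form_skew[of "basis i" "basis j"] by linarith
  then have "\<not> positive_realization D'" for D' :: "('m, 'r) walls"
  proof cases
    case 1
    then show ?thesis using not_positive_realization assms(3,5,6) by blast
  next
    case 2
    then show ?thesis using not_positive_realization assms(3)[symmetric] assms(6,5) by blast
  qed
  then show ?thesis by (simp add: positive_def)
qed

end
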